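(* Let $1\le n\le m$ be integers, $\mathbb{K}=\mathbb{R}$ or $\mathbb{C}$, and $r>0$. The function $\alpha(A)=1/\sigma_n^2(A)$ is self-convex in the sphere $\mathbb{S}_r(\mathbb{GL}_{n,m}^>)=\{A\in\mathbb{GL}_{n,m}^>:\|A\|_F=r\}$ of radius $r$ in $\mathbb{GL}_{n,m}^>$.
   Context: The singular values of $A\in\mathbb{K}^{n\times m}$ are $\sigma_1(A)\ge\cdots\ge\sigma_n(A)\ge0$. $\mathbb{GL}_{n,m}^>$ is the open set of matrices $A\in\mathbb{K}^{n\times m}$ of rank $n$ with $\sigma_{n-1}(A)>\sigma_n(A)$ (the smallest singular value is simple). $\mathbb{K}^{n\times m}$ carries the real inner product $\mathrm{Re}\langle M,N\rangle_F$, $\langle M,N\rangle_F=\mathrm{trace}(N^*M)$, with norm $\|\cdot\|_F$, and $\mathbb{S}_r(\mathbb{GL}_{n,m}^>)$ carries the induced Riemannian metric. Self-convexity: let $(\mathcal{M},\langle\cdot,\cdot\rangle)$ be a Riemannian manifold and $\alpha:\mathcal{M}\to\mathbb{R}$ a $C^2$ function with positive values. Let $\mathcal{M}_\kappa$ be $\mathcal{M}$ with the new metric $\langle\cdot,\cdot\rangle_{\kappa,x}=\alpha(x)\langle\cdot,\cdot\rangle_x$. The function $\alpha$ is self-convex when $t\mapsto\log\alpha(\gamma(t))$ is convex for every geodesic $\gamma$ in $\mathcal{M}_\kappa$. *)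

theory Defs
  imports "HOL-Analysis.Analysis" "Jordan_Normal_Form.Conjugate"
begin

section \<open>Singular values\<close>

text \<open>An element of type \<open>'k^'m^'n\<close> is a matrix with \<open>CARD('n)\<close> rows and \<open>CARD('m)\<close> columns. The
  sort \<open>conjugatable_field\<close> provides the conjugation of the field: \<open>cnj\<close> on the complex numbers,
  the identity on the reals.\<close>

definition conj_transpose :: "'k::conjugatable_field^'m^'n \<Rightarrow> 'k^'n^'m"
  where "conj_transpose A = (\<chi> i j. conjugate (A $ j $ i))"

definition charpoly :: "'k::field^'n^'n \<Rightarrow> 'k poly"
  where "charpoly B = det (\<chi> i j. (if i = j then [:0, 1:] else 0) - [:B $ i $ j:])"

text \<open>The \<open>CARD('n)\<close> singular values of an \<open>n \<times> m\<close> matrix \<open>A\<close> with \<open>n \<le> m\<close>, in decreasing order: the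
  square roots of the eigenvalues of \<open>A A\<^sup>*\<close>, repeated according to multiplicity. These eigenvalues
  are nonnegative reals, so \<open>norm\<close> merely reads an eigenvalue as a real number.\<close>

definition singular_values :: "'k::{conjugatable_field, real_normed_field}^'m^'n \<Rightarrow> real list"
  where "singular_values A =
    rev (sorted_list_of_multiset
      (image_mset (\<lambda>z. sqrt (norm z)) (proots (charpoly (A ** conj_transpose A)))))"

definition sing_val :: "nat \<Rightarrow> 'k::{conjugatable_field, real_normed_field}^'m^'n \<Rightarrow> real"
  where "sing_val k A = singular_values A ! (k - 1)"

text \<open>For a single row there is no \<open>\<sigma>\<^sub>n\<^sub>-\<^sub>1\<close>, and the only singular value is simple.\<close>

definition GL_simple :: "('k::{conjugatable_field, real_normed_field}^'m^'n) set"
  where "GL_simple = {A. rank A = CARD('n) \<and>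
    (1 < CARD('n) \<longrightarrow> sing_val (CARD('n) - 1) A > sing_val CARD('n) A)}"

text \<open>The library's inner product on matrices is the real part of the Frobenius product, so that
  \<open>norm\<close> is the Frobenius norm.\<close>

lemma inner_matrix_real:
  fixes M N :: "real^'m^'n"
  shows "M \<bullet> N = trace (conj_transpose N ** M)"
  unfolding inner_vec_def trace_def matrix_matrix_mult_def conj_transpose_def
  by (subst sum.swap) (simp add: mult.commute)

lemma inner_matrix_complex:
  fixes M N :: "complex^'m^'n"
  shows "M \<bullet> N = Re (trace (conj_transpose N ** M))"
  unfolding inner_vec_def trace_def matrix_matrix_mult_def conj_transpose_def
  by (subst sum.swap) (simp add: inner_complex_def algebra_simps)

definition sphere_GL :: "real \<Rightarrow> ('k::{conjugatable_field, real_normed_field, euclidean_space}^'m^'n) set"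
  where "sphere_GL r = {A \<in> GL_simple. norm A = r}"


section \<open>Submanifolds of a Euclidean space\<close>

text \<open>\<open>C\<^sup>k\<close> on an open subset \<open>S\<close> of a Euclidean space.\<close>

primrec Ck_on :: "nat \<Rightarrow> 'a::euclidean_space set \<Rightarrow> ('a \<Rightarrow> 'b::real_normed_vector) \<Rightarrow> bool"
  where
    "Ck_on 0 S f \<longleftrightarrow> continuous_on S f"
  | "Ck_on (Suc k) S f \<longleftrightarrow> (\<forall>x\<in>S. f differentiable (at x)) \<and>
       (\<forall>v. Ck_on k S (\<lambda>x. frechet_derivative f (at x) v))"

definition smooth_on :: "'a::euclidean_space set \<Rightarrow> ('a \<Rightarrow> 'b::real_normed_vector) \<Rightarrow> bool"
  where "smooth_on S f \<longleftrightarrow> (\<forall>k. Ck_on k S f)"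

text \<open>A slice chart of \<open>M\<close>: a diffeomorphism \<open>\<psi>\<close> from an open set \<open>\<Omega>\<close> onto an open set, with inverse
  \<open>\<phi>\<close>, that carries the part of the linear subspace \<open>V\<close> in \<open>\<Omega>\<close> onto the part of \<open>M\<close> in \<open>\<psi> ` \<Omega>\<close>.
  Restricted to \<open>\<Omega> \<inter> V\<close> it is a local parametrization of \<open>M\<close> by an open subset of \<open>V\<close>.\<close>

definition slice_chart ::
    "'e::euclidean_space set \<Rightarrow> 'e set \<Rightarrow> 'e set \<Rightarrow> ('e \<Rightarrow> 'e) \<Rightarrow> ('e \<Rightarrow> 'e) \<Rightarrow> bool"
  where "slice_chart M V \<Omega> \<psi> \<phi> \<longleftrightarrow>
    subspace V \<and> open \<Omega> \<and> open (\<psi> ` \<Omega>) \<and> smooth_on \<Omega> \<psi> \<and> smooth_on (\<psi> ` \<Omega>) \<phi> \<and>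
    (\<forall>u\<in>\<Omega>. \<phi> (\<psi> u) = u) \<and> \<psi> ` (\<Omega> \<inter> V) = M \<inter> \<psi> ` \<Omega>"

definition submanifold :: "'e::euclidean_space set \<Rightarrow> bool"
  where "submanifold M \<longleftrightarrow>
    (\<exists>d. \<forall>p\<in>M. \<exists>V \<Omega> \<psi> \<phi>. slice_chart M V \<Omega> \<psi> \<phi> \<and> p \<in> \<psi> ` \<Omega> \<and> dim V = d)"

text \<open>A function on \<open>M\<close> is \<open>C\<^sup>k\<close> if it extends locally to a \<open>C\<^sup>k\<close> function on an open set.\<close>

definition Ck_on_submanifold :: "nat \<Rightarrow> 'e::euclidean_space set \<Rightarrow> ('e \<Rightarrow> real) \<Rightarrow> bool"
  where "Ck_on_submanifold k M f \<longleftrightarrow>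
    (\<forall>p\<in>M. \<exists>W F. open W \<and> p \<in> W \<and> Ck_on k W F \<and> (\<forall>x\<in>M \<inter> W. F x = f x))"


section \<open>Geodesics\<close>

text \<open>A Riemannian metric on \<open>M\<close> is given by \<open>g :: 'e \<Rightarrow> 'e \<Rightarrow> 'e \<Rightarrow> real\<close>, of which only the values
  \<open>g p v w\<close> for \<open>p \<in> M\<close> and \<open>v\<close>, \<open>w\<close> tangent to \<open>M\<close> at \<open>p\<close> matter. Its expression in a chart:\<close>

definition chart_metric ::
    "('e::euclidean_space \<Rightarrow> 'e \<Rightarrow> 'e \<Rightarrow> real) \<Rightarrow> ('e \<Rightarrow> 'e) \<Rightarrow> 'e \<Rightarrow> 'e \<Rightarrow> 'e \<Rightarrow> real"
  where "chart_metric g \<psi> u x y =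
    g (\<psi> u) (frechet_derivative \<psi> (at u) x) (frechet_derivative \<psi> (at u) y)"

text \<open>Christoffel symbols of the first kind, \<open>\<Gamma>(x, y; w) = G(\<nabla>\<^sub>x y, w)\<close> for the Levi-Civita connection
  \<open>\<nabla>\<close> of \<open>G\<close> and constant vector fields \<open>x\<close>, \<open>y\<close>, \<open>w\<close> (Koszul's formula). The directional
  derivatives only involve \<open>G\<close> along \<open>V\<close> when \<open>u, x, y, w \<in> V\<close>.\<close>

definition christoffel ::
    "('e::real_vector \<Rightarrow> 'e \<Rightarrow> 'e \<Rightarrow> real) \<Rightarrow> 'e \<Rightarrow> 'e \<Rightarrow> 'e \<Rightarrow> 'e \<Rightarrow> real"
  where "christoffel G u x y w =
    (deriv (\<lambda>s. G (u + s *\<^sub>R x) y w) 0 + deriv (\<lambda>s. G (u + s *\<^sub>R y) x w) 0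
      - deriv (\<lambda>s. G (u + s *\<^sub>R w) x y) 0) / 2"

text \<open>A geodesic has vanishing covariant acceleration: in every chart, the coordinate expression
  \<open>u = \<phi> \<circ> \<gamma>\<close> satisfies \<open>u'' + \<Gamma>(u', u') = 0\<close>, here paired with an arbitrary \<open>w\<close> in \<open>V\<close>, which loses
  nothing as the metric is nondegenerate. \<open>I\<close> is any interval, with one-sided derivatives at the
  end points that belong to it.\<close>

definition geodesic ::
    "'e::euclidean_space set \<Rightarrow> ('e \<Rightarrow> 'e \<Rightarrow> 'e \<Rightarrow> real) \<Rightarrow> real set \<Rightarrow> (real \<Rightarrow> 'e) \<Rightarrow> bool"
  where "geodesic M g I \<gamma> \<longleftrightarrow>
    is_interval I \<and> \<gamma> ` I \<subseteq> M \<and> continuous_on I \<gamma> \<and>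
    (\<forall>V \<Omega> \<psi> \<phi>. slice_chart M V \<Omega> \<psi> \<phi> \<longrightarrow>
      (\<exists>u' u''. \<forall>t\<in>I. \<gamma> t \<in> \<psi> ` \<Omega> \<longrightarrow>
        ((\<lambda>s. \<phi> (\<gamma> s)) has_vector_derivative u' t) (at t within I) \<and>
        (u' has_vector_derivative u'' t) (at t within I) \<and>
        (\<forall>w\<in>V. chart_metric g \<psi> (\<phi> (\<gamma> t)) (u'' t) w
                + christoffel (chart_metric g \<psi>) (\<phi> (\<gamma> t)) (u' t) (u' t) w = 0)))"


section \<open>Self-convexity\<close>

text \<open>Self-convexity of \<open>\<alpha>\<close> on the submanifold \<open>M\<close> with Riemannian metric \<open>g\<close>.\<close>

definition self_convex ::
    "'e::euclidean_space set \<Rightarrow> ('e \<Rightarrow> 'e \<Rightarrow> 'e \<Rightarrow> real) \<Rightarrow> ('e \<Rightarrow> real) \<Rightarrow> bool"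
  where "self_convex M g \<alpha> \<longleftrightarrow>
    submanifold M \<and> Ck_on_submanifold 2 M \<alpha> \<and> (\<forall>x\<in>M. \<alpha> x > 0) \<and>
    (\<forall>I \<gamma>. geodesic M (\<lambda>x v w. \<alpha> x * g x v w) I \<gamma> \<longrightarrow> convex_on I (\<lambda>t. ln (\<alpha> (\<gamma> t))))"

definition induced_metric :: "'e::euclidean_space \<Rightarrow> 'e \<Rightarrow> 'e \<Rightarrow> real"
  where "induced_metric x v w = v \<bullet> w"

end

theory Submission
  imports Defs "HOL-Computational_Algebra.Fundamental_Theorem_Algebra"
begin

text \<open>
  Let \<open>\<lambda>(A)\<close> be the square of the smallest singular value of \<open>A\<close>, that is, the smallest eigenvalue of
  \<open>A A\<^sup>*\<close>. For a unit vector \<open>x\<close> the form \<open>q(A) = |A\<^sup>* x|\<^sup>2 = A \<bullet> (x x\<^sup>* A)\<close> is the quadratic form of an orthogonal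
  projection \<open>S\<close> of the space of matrices, and \<open>\<lambda>\<close> is the minimum of these forms over \<open>x\<close>. Apart from
  the smoothness of \<open>\<lambda>\<close>, this is all that the geometric argument needs to know about singular values,
  and \<open>self_convex_sphere\<close> is stated for such functions on a Euclidean space.

  Let \<open>\<gamma>\<close> be a geodesic of the metric \<open>\<lambda>\<^sup>-\<^sup>1 (\<cdot> \<bullet> \<cdot>)\<close> on the sphere, let \<open>p = \<gamma>(t)\<close>, and let \<open>S\<close> be a projection
  whose form \<open>q\<close> touches \<open>\<lambda>\<close> at \<open>p\<close>. As \<open>\<lambda> \<le> q\<close>, the function \<open>- log q(\<gamma>)\<close> lies below \<open>log \<alpha>(\<gamma>) = - log \<lambda>(\<gamma>)\<close>
  and agrees with it at \<open>t\<close>. By \<open>convex_on_if_lower_support\<close> it suffices that the second derivative of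
  such a support function is nonnegative at \<open>t\<close>, so no second derivative of \<open>\<lambda>\<close> enters.

  That derivative is computed in the inversion chart of the sphere centred at \<open>p\<close>, where the metric is a
  multiple of the flat one whose conformal factor is stationary at the centre. The vector \<open>G = S p\<close> is half
  the gradient of \<open>\<lambda>\<close> at \<open>p\<close>, and for coordinate velocity \<open>v\<close> and acceleration \<open>a\<close> the geodesic equation reads
  \<open>\<lambda> (a \<bullet> w) = 4 (G \<bullet> v) (v \<bullet> w) - 2 (G \<bullet> w) (v \<bullet> v)\<close> for all \<open>w\<close> orthogonal to \<open>p\<close>
  (\<open>geodesic_equation_at_centre\<close>). Taking for \<open>w\<close> the tangential part of \<open>G\<close>, and using \<open>G \<bullet> G = G \<bullet> p = \<lambda>\<close>,
  one finds \<open>q q'' = q'\<^sup>2 + 8 q (v \<bullet> S v - v \<bullet> v) \<le> q'\<^sup>2\<close>, which says that \<open>(- log q)'' \<ge> 0\<close>.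

  It remains to see that \<open>\<lambda>\<close> is smooth on an open set of matrices. A minimizer \<open>x\<close> is an eigenvector, all
  roots of the characteristic polynomial of \<open>A A\<^sup>*\<close> are real and at least \<open>\<lambda>\<close>, and the polynomial splits;
  so \<open>A\<close> has full rank and a simple smallest singular value if and only if \<open>\<lambda> > 0\<close> and \<open>\<lambda>\<close> is a simple root.
  Both conditions are open because \<open>\<lambda>\<close> is continuous, and a simple root depends smoothly on the
  coefficients (\<open>Ck_on_simple_root\<close>).

  The class \<open>rc_field\<close> treats both scalar fields at once. Only the splitting of the characteristic
  polynomial is proved separately: over the complex numbers it is the fundamental theorem of algebra, and
  over the reals it follows because the eigenvalues of the complexified matrix are real.
\<close>

section \<open>Calculus of continuously differentiable functions\<close>

lemma Ck_on_cong:
  assumes "open S" "\<And>x. x \<in> S \<Longrightarrow> f x = g x" "Ck_on k S f"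
  shows "Ck_on k S g"
  using assms(2,3)
proof (induction k arbitrary: f g)
  case 0
  then show ?case by (simp cong: continuous_on_cong)
next
  case (Suc k)
  have d: "f differentiable (at x)" if "x \<in> S" for x
    using Suc.prems that by simp
  have "g differentiable (at x)" if x: "x \<in> S" for x
  proof -
    obtain D where "(f has_derivative D) (at x)" using d[OF x] unfolding differentiable_def by blast
    then have "(g has_derivative D) (at x)"
      by (rule has_derivative_transform_within_open[OF _ \<open>open S\<close> x]) (rule Suc.prems(1))
    then show ?thesis by (rule differentiableI)
  qed
  moreover have "frechet_derivative f (at x) = frechet_derivative g (at x)" if "x \<in> S" for x
    by (rule frechet_derivative_transform_within_open[OF d[OF that] \<open>open S\<close> that Suc.prems(1)])
  ultimately show ?case
    using Suc.prems(2) Suc.IH[where f = "\<lambda>x. frechet_derivative f (at x) v"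
        and g = "\<lambda>x. frechet_derivative g (at x) v" for v] by simp
qed

text \<open>\<open>Ck_on\<close> refers to \<open>frechet_derivative\<close>, a choice operator; this rule lets any explicitly known
  derivative take its place.\<close>

lemma Ck_on_has_derivI:
  assumes "open S" "\<And>x. x \<in> S \<Longrightarrow> (f has_derivative f' x) (at x)"
    and "\<And>v. Ck_on k S (\<lambda>x. f' x v)"
  shows "Ck_on (Suc k) S f"
proof -
  have "f' x = frechet_derivative f (at x)" if "x \<in> S" for x
    using frechet_derivative_at[OF assms(2)[OF that]] .
  then have "Ck_on k S (\<lambda>x. frechet_derivative f (at x) v)" for v
    by (intro Ck_on_cong[OF \<open>open S\<close> _ assms(3)[of v]]) simp
  moreover have "f differentiable (at x)" if "x \<in> S" for x
    using assms(2)[OF that] differentiableI by blast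
  ultimately show ?thesis by simp
qed

lemma Ck_on_Suc_has_derivative:
  assumes "Ck_on (Suc k) S f" "x \<in> S"
  shows "(f has_derivative frechet_derivative f (at x)) (at x)"
  using assms by (simp add: frechet_derivative_works[symmetric])

lemma Ck_on_Suc_imp:
  assumes "Ck_on (Suc k) S f"
  shows "Ck_on k S f"
  using assms
proof (induction k arbitrary: f)
  case 0
  then show ?case
    by (auto intro!: continuous_at_imp_continuous_on differentiable_imp_continuous_within)
next
  case (Suc k)
  then show ?case by simp
qed

lemma Ck_on_imp_continuous_on:
  assumes "Ck_on k S f"
  shows "continuous_on S f"
  using assms by (induction k) (auto dest: Ck_on_Suc_imp simp del: Ck_on.simps(2))

lemma Ck_on_const: "open S \<Longrightarrow> Ck_on k S (\<lambda>x. c)"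
proof (induction k arbitrary: c)
  case (Suc k)
  show ?case
    by (rule Ck_on_has_derivI[where f' = "\<lambda>_ _. 0"]) (use Suc in auto)
qed auto

lemma Ck_on_bounded_linear:
  assumes "open S" "bounded_linear L"
  shows "Ck_on k S L"
proof (cases k)
  case 0
  then show ?thesis using assms by (simp add: linear_continuous_on)
next
  case (Suc k)
  show ?thesis unfolding Suc
    by (rule Ck_on_has_derivI[where f' = "\<lambda>_. L"])
      (use assms Ck_on_const in \<open>auto intro: bounded_linear_imp_has_derivative\<close>)
qed

lemma Ck_on_add:
  assumes "open S" "Ck_on k S f" "Ck_on k S g"
  shows "Ck_on k S (\<lambda>x. f x + g x)"
  using assms(2,3)
proof (induction k arbitrary: f g)
  case (Suc k)
  show ?case
    by (rule Ck_on_has_derivI[OF \<open>open S\<close> has_derivative_add])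
      (use Suc in \<open>auto intro: Ck_on_Suc_has_derivative\<close>)
qed (auto intro: continuous_intros)

lemma Ck_on_bilinear:
  assumes "open S" "bounded_bilinear b" "Ck_on k S f" "Ck_on k S g"
  shows "Ck_on k S (\<lambda>x. b (f x) (g x))"
  using assms(3,4)
proof (induction k arbitrary: f g)
  case 0
  then show ?case
    by (simp add: bounded_bilinear.continuous_on[OF assms(2)])
next
  case (Suc k)
  have "Ck_on k S f" "Ck_on k S g" using Suc.prems Ck_on_Suc_imp by blast+
  with Suc show ?case
    by (intro Ck_on_has_derivI[OF \<open>open S\<close> bounded_bilinear.FDERIV[OF assms(2)
          Ck_on_Suc_has_derivative[of k] Ck_on_Suc_has_derivative[of k]]] Ck_on_add \<open>open S\<close> Suc.IH)
      simp_all
qed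

lemma Ck_on_linear_comp:
  assumes "open S" "bounded_linear L" "Ck_on k S f"
  shows "Ck_on k S (\<lambda>x. L (f x))"
  using assms(3)
proof (induction k arbitrary: f)
  case 0
  then show ?case using assms(2) by (simp add: bounded_linear.continuous_on)
next
  case (Suc k)
  show ?case
    by (rule Ck_on_has_derivI[OF \<open>open S\<close> bounded_linear.has_derivative[OF assms(2)]])
      (use Suc in \<open>auto intro: Ck_on_Suc_has_derivative\<close>)
qed

lemma Ck_on_inverse:
  fixes f :: "'a::euclidean_space \<Rightarrow> 'b::real_normed_field"
  assumes "open S" "Ck_on k S f" "\<And>x. x \<in> S \<Longrightarrow> f x \<noteq> 0"
  shows "Ck_on k S (\<lambda>x. inverse (f x))"
  using assms(2)
proof (induction k)
  case 0
  then show ?case using assms(3) by (auto intro: continuous_intros)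
next
  case (Suc k)
  have IH: "Ck_on k S (\<lambda>x. inverse (f x))" using Suc Ck_on_Suc_imp by blast
  have "Ck_on k S (\<lambda>x. (-1) * (inverse (f x) * frechet_derivative f (at x) v * inverse (f x)))" for v
    by (intro Ck_on_bilinear[OF \<open>open S\<close> bounded_bilinear_mult] Ck_on_const \<open>open S\<close> IH)
      (use Suc.prems in auto)
  then show ?case
    by (intro Ck_on_has_derivI[OF \<open>open S\<close> Deriv.has_derivative_inverse])
      (use Suc.prems assms(3) in \<open>auto intro: Ck_on_Suc_has_derivative\<close>)
qed

lemma Ck_on_sum:
  assumes "open S" "\<And>i. i \<in> I \<Longrightarrow> Ck_on k S (f i)"
  shows "Ck_on k S (\<lambda>x. \<Sum>i\<in>I. f i x)"
  using assms(2)
  by (induction I rule: infinite_finite_induct) (auto intro: Ck_on_const Ck_on_add \<open>open S\<close>)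

lemmas Ck_on_mult = Ck_on_bilinear[OF _ bounded_bilinear_mult]

lemma Ck_on_power:
  fixes f :: "'a::euclidean_space \<Rightarrow> 'b::real_normed_field"
  assumes "open S" "Ck_on k S f"
  shows "Ck_on k S (\<lambda>x. f x ^ n)"
  by (induction n) (auto intro: Ck_on_const Ck_on_mult assms)

section \<open>Inversion charts of the sphere\<close>

text \<open>The inversion with centre \<open>- p\<close> and squared radius \<open>2 (norm p)\<^sup>2\<close>. It exchanges the hyperplane orthogonal to \<open>p\<close>
  with the sphere through \<open>p\<close> around the origin and sends \<open>0\<close> to \<open>p\<close>. It serves as a chart because it
  is rational, its own inverse, and conformal.\<close>

definition sphere_chart :: "'e::euclidean_space \<Rightarrow> 'e \<Rightarrow> 'e"
  where "sphere_chart p u = (2 * (norm p)\<^sup>2 / (norm (u + p))\<^sup>2) *\<^sub>R (u + p) - p"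

lemma norm_sphere_chart_add:
  "u \<noteq> - p \<Longrightarrow> (norm (sphere_chart p u + p))\<^sup>2 = 4 * (norm p) ^ 4 / (norm (u + p))\<^sup>2"
  unfolding sphere_chart_def
  by (simp add: power_mult_distrib power_divide add_eq_0_iff2 divide_simps)

lemma sphere_chart_involution:
  assumes "p \<noteq> 0" "u \<noteq> - p"
  shows "sphere_chart p (sphere_chart p u) = u"
proof -
  have "sphere_chart p u + p = (2 * (norm p)\<^sup>2 / (norm (u + p))\<^sup>2) *\<^sub>R (u + p)"
    by (simp add: sphere_chart_def)
  then show ?thesis
    using assms norm_sphere_chart_add[OF assms(2)]
    by (subst sphere_chart_def) (simp add: add_eq_0_iff2 eval_nat_numeral)
qed

lemma sphere_chart_neq: "p \<noteq> 0 \<Longrightarrow> u \<noteq> - p \<Longrightarrow> sphere_chart p u \<noteq> - p"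
  by (simp add: sphere_chart_def add_eq_0_iff2)

lemma norm_sphere_chart:
  assumes "p \<noteq> 0" "u \<noteq> - p"
  shows "norm (sphere_chart p u) = norm p \<longleftrightarrow> p \<bullet> u = 0"
proof -
  define c where "c = 2 * (norm p)\<^sup>2 / (norm (u + p))\<^sup>2"
  have n: "norm (u + p) \<noteq> 0" using assms by (simp add: add_eq_0_iff2)
  have c: "c > 0" using n assms by (simp add: c_def)
  have cn: "c * (norm (u + p))\<^sup>2 = 2 * (norm p)\<^sup>2" using n by (simp add: c_def)
  have "(norm (c *\<^sub>R w - p))\<^sup>2 = (c * (norm w)\<^sup>2) * c - 2 * c * (w \<bullet> p) + (norm p)\<^sup>2" for w
    unfolding power2_norm_eq_inner by (simp add: inner_simps algebra_simps inner_commute)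
  from this[of "u + p"]
  have "(norm (sphere_chart p u))\<^sup>2 = (2 * (norm p)\<^sup>2) * c - 2 * c * ((u + p) \<bullet> p) + (norm p)\<^sup>2"
    by (simp only: sphere_chart_def c_def[symmetric] cn)
  also have "\<dots> = (norm p)\<^sup>2 - 2 * c * ((u + p) \<bullet> p - p \<bullet> p)"
    by (simp add: power2_norm_eq_inner algebra_simps)
  also have "\<dots> = (norm p)\<^sup>2 - 2 * c * (p \<bullet> u)"
    by (simp add: inner_simps inner_commute)
  finally have "(norm (sphere_chart p u))\<^sup>2 = (norm p)\<^sup>2 \<longleftrightarrow> p \<bullet> u = 0" using c by simp
  then show ?thesis by simp
qed

text \<open>The derivative of an inversion is a positive multiple of the reflection in the hyperplane orthogonal
  to \<open>w\<close>, which is what makes inversions conformal.\<close>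

lemma has_derivative_inversion:
  fixes w :: "'e::real_inner"
  assumes "w \<noteq> 0"
  shows "((\<lambda>w. (c / (norm w)\<^sup>2) *\<^sub>R w) has_derivative
     (\<lambda>x. (c / (norm w)\<^sup>2) *\<^sub>R (x - (2 * (w \<bullet> x) / (norm w)\<^sup>2) *\<^sub>R w))) (at w)"
proof -
  have "w \<bullet> w \<noteq> 0" using assms by simp
  then show ?thesis
    unfolding power2_norm_eq_inner
    by (auto intro!: derivative_eq_intros
        simp: fun_eq_iff scaleR_diff_right inner_commute divide_simps power2_eq_square)
qed

lemma sphere_chart_has_derivative:
  assumes "u \<noteq> - p"
  shows "(sphere_chart p has_derivative
     (\<lambda>x. (2 * (norm p)\<^sup>2 / (norm (u + p))\<^sup>2) *\<^sub>R
            (x - (2 * ((u + p) \<bullet> x) / (norm (u + p))\<^sup>2) *\<^sub>R (u + p)))) (at u)"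
proof -
  have "u + p \<noteq> 0" using assms by (simp add: add_eq_0_iff2)
  then have "((\<lambda>w. (2 * (norm p)\<^sup>2 / (norm w)\<^sup>2) *\<^sub>R w) has_derivative
     (\<lambda>x. (2 * (norm p)\<^sup>2 / (norm (u + p))\<^sup>2) *\<^sub>R
            (x - (2 * ((u + p) \<bullet> x) / (norm (u + p))\<^sup>2) *\<^sub>R (u + p)))) (at (u + p))"
    by (rule has_derivative_inversion)
  moreover have "((\<lambda>u. u + p) has_derivative (\<lambda>x. x)) (at u)"
    by (auto intro!: derivative_eq_intros)
  ultimately show ?thesis
    unfolding sphere_chart_def
    using has_derivative_diff[OF has_derivative_compose has_derivative_const] by fastforce
qed

lemma smooth_sphere_chart:
  assumes "open S" "- p \<notin> S"
  shows "smooth_on S (sphere_chart p)"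
  unfolding smooth_on_def
proof
  fix k
  have t: "Ck_on k S (\<lambda>u. u + p)"
    by (intro Ck_on_add Ck_on_const Ck_on_bounded_linear bounded_linear_ident assms)
  have "Ck_on k S (\<lambda>u. (2 * (norm p)\<^sup>2 * inverse ((u + p) \<bullet> (u + p))) *\<^sub>R (u + p) + (- p))"
    by (intro Ck_on_bilinear[OF _ bounded_bilinear_scaleR] Ck_on_mult Ck_on_add Ck_on_inverse
         Ck_on_bilinear[OF _ bounded_bilinear_inner] Ck_on_const Ck_on_bounded_linear bounded_linear_ident assms)
      (use assms in \<open>auto simp: add_eq_0_iff2\<close>)
  then show "Ck_on k S (sphere_chart p)"
    by (rule Ck_on_cong[OF \<open>open S\<close>, rotated])
      (simp add: sphere_chart_def power2_norm_eq_inner divide_inverse)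
qed

text \<open>The chart covers all of the sphere but the antipode \<open>- p\<close>, where the inversion is not defined;
  restricting to the open set \<open>U\<close> only shrinks its domain.\<close>

lemma slice_chart_sphere:
  fixes U :: "'e::euclidean_space set"
  assumes "open U" "p \<in> U" "norm p = r" "r > 0"
  defines "\<Omega> \<equiv> sphere_chart p ` (U - {- p})"
  shows "slice_chart {x \<in> U. norm x = r} {v. p \<bullet> v = 0} \<Omega> (sphere_chart p) (sphere_chart p)"
    and "p \<in> sphere_chart p ` \<Omega>"
    and "sphere_chart p ` \<Omega> = U - {- p}"
proof -
  have p: "p \<noteq> 0" using assms by auto
  show img: "sphere_chart p ` \<Omega> = U - {- p}"
    unfolding \<Omega>_def image_image using sphere_chart_involution[OF p] by (auto simp: image_iff)
  have O: "\<Omega> = {u \<in> - {- p}. sphere_chart p u \<in> U}"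
    unfolding \<Omega>_def using sphere_chart_involution[OF p] sphere_chart_neq[OF p] by (force simp: image_iff)
  have cont: "continuous_on (- {- p}) (sphere_chart p)"
    by (intro continuous_at_imp_continuous_on ballI)
      (auto intro: has_derivative_continuous sphere_chart_has_derivative)
  have "open \<Omega>"
    unfolding O using continuous_open_preimage[OF cont _ \<open>open U\<close>]
    by (simp add: open_Compl vimage_def Int_def)
  moreover have "open (sphere_chart p ` \<Omega>)"
    unfolding img using \<open>open U\<close> by (simp add: open_delete)
  moreover have "sphere_chart p ` (\<Omega> \<inter> {v. p \<bullet> v = 0}) = {x \<in> U. norm x = r} \<inter> sphere_chart p ` \<Omega>"
    using norm_sphere_chart[OF p] \<open>norm p = r\<close> by (auto simp: O)
  moreover have "- p \<notin> \<Omega>" "- p \<notin> sphere_chart p ` \<Omega>"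
    unfolding img by (auto simp: O)
  moreover have "\<forall>u\<in>\<Omega>. sphere_chart p (sphere_chart p u) = u"
    using sphere_chart_involution[OF p] by (auto simp: O)
  ultimately show "slice_chart {x \<in> U. norm x = r} {v. p \<bullet> v = 0} \<Omega> (sphere_chart p) (sphere_chart p)"
    unfolding slice_chart_def
    by (auto intro: smooth_sphere_chart subspace_hyperplane)
  show "p \<in> sphere_chart p ` \<Omega>"
    unfolding img using p \<open>p \<in> U\<close> by (auto simp: eq_neg_iff_add_eq_0 simp flip: scaleR_2)
qed

lemma submanifold_sphere:
  fixes U :: "'e::euclidean_space set"
  assumes "open U" "r > 0"
  shows "submanifold {x \<in> U. norm x = r}"
proof -
  have "\<exists>V \<Omega> \<psi> \<phi>. slice_chart {x \<in> U. norm x = r} V \<Omega> \<psi> \<phi> \<and> p \<in> \<psi> ` \<Omega> \<and> dim V = DIM('e) - 1"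
    if "p \<in> U" "norm p = r" for p
  proof -
    have "p \<noteq> 0" using that assms by auto
    then show ?thesis
      using slice_chart_sphere(1,2)[OF \<open>open U\<close> that \<open>r > 0\<close>] dim_hyperplane[of p] by blast
  qed
  then show ?thesis unfolding submanifold_def by blast
qed

section \<open>Convexity from lower support functions\<close>

text \<open>A continuous function that is touched from below at every interior point by a function with
  nonnegative second derivative there is convex. If it exceeded a chord, then after adding a small
  strictly convex parabola that vanishes at the ends of the chord it would still have an interior
  maximum over the chord; the support function would have a local maximum at that point as well,
  although its second derivative is positive.

  This makes it possible to bound the convexity of \<open>- ln \<circ> f \<circ> \<gamma>\<close> without second derivatives of \<open>f\<close>.\<close>

lemma convex_on_if_lower_support:
  fixes f :: "real \<Rightarrow> real"
  assumes I: "is_interval I" and cont: "continuous_on I f"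
    and supp: "\<And>t. t \<in> interior I \<Longrightarrow> \<exists>h h' c. h t = f t \<and> (\<forall>\<^sub>F s in nhds t. h s \<le> f s) \<and>
      (\<forall>\<^sub>F s in nhds t. (h has_real_derivative h' s) (at s)) \<and>
      (h' has_real_derivative c) (at t) \<and> c \<ge> 0"
  shows "convex_on I f"
proof (rule convex_on_linorderI)
  show "convex I" using I by (simp add: is_interval_convex)
  fix l x y :: real assume l: "l > 0" "l < 1" and xy: "x \<in> I" "y \<in> I" "x < y"
  define m where "m = (f y - f x) / (y - x)"
  define z where "z = (1 - l) * x + l * y"
  have zx: "z - x = l * (y - x)" and zy: "y - z = (1 - l) * (y - x)"
    by (simp_all add: z_def algebra_simps)
  have "0 < l * (y - x)" "0 < (1 - l) * (y - x)" using l xy by simp_all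
  then have z: "x < z" "z < y" unfolding zx[symmetric] zy[symmetric] by simp_all
  have "f z \<le> f x + m * (z - x)"
  proof (rule ccontr)
    assume "\<not> ?thesis"
    then have \<delta>: "f z - (f x + m * (z - x)) > 0" by simp
    \<comment> \<open>Half of the excess over the chord at \<open>z\<close> pays for the parabola \<open>e * (s - x) * (y - s)\<close>.\<close>
    define e where "e = (f z - (f x + m * (z - x))) / (2 * ((z - x) * (y - z)))"
    have e: "e > 0" using \<delta> z by (simp add: e_def)
    have ez: "e * ((z - x) * (y - z)) = (f z - (f x + m * (z - x))) / 2"
      using z by (simp add: e_def)
    define k where "k h s = h s - (f x + m * (s - x)) - e * ((s - x) * (y - s))" for h :: "real \<Rightarrow> real" and s
    have sub: "{x..y} \<subseteq> I" using I xy unfolding is_interval_1 by (meson atLeastAtMost_iff subsetI)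
    have "continuous_on {x..y} (k f)"
      unfolding k_def by (intro continuous_intros continuous_on_subset[OF cont sub])
    then obtain t where t: "t \<in> {x..y}" and max: "\<And>s. s \<in> {x..y} \<Longrightarrow> k f s \<le> k f t"
      using continuous_attains_sup[of "{x..y}" "k f"] xy by (metis compact_Icc atLeastatMost_empty_iff less_imp_le)
    have "k f z > 0" unfolding k_def ez using \<delta> by simp
    with max[of z] z have "k f t > 0" by auto
    moreover have "k f x = 0" "k f y = 0" using xy by (simp_all add: k_def m_def)
    ultimately have "t \<noteq> x" "t \<noteq> y" by auto
    with t have t': "x < t" "t < y" by simp_all
    then have nt: "\<forall>\<^sub>F s in nhds t. s \<in> {x<..<y}" by (intro eventually_nhds_in_open) auto
    have "t \<in> interior I" using t' sub by (intro interiorI[of "{x<..<y}"]) auto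
    from supp[OF this] obtain h h' c where h: "h t = f t" "\<forall>\<^sub>F s in nhds t. h s \<le> f s"
      "\<forall>\<^sub>F s in nhds t. (h has_real_derivative h' s) (at s)" "(h' has_real_derivative c) (at t)" "c \<ge> 0"
      by (elim exE conjE) (rule that)
    define d where "d s = h' s - m - e * (x + y - 2 * s)" for s
    have "\<forall>\<^sub>F s in nhds t. (k h has_real_derivative d s) (at s) \<and> k h s \<le> k h t"
      using h(2,3) nt
    proof eventually_elim
      case (elim s)
      have "(k h has_real_derivative d s) (at s)"
        unfolding k_def d_def by (auto intro!: derivative_eq_intros elim simp: algebra_simps)
      moreover have "k h s \<le> k f s" using elim by (simp add: k_def)
      moreover have "k f t = k h t" using h by (simp add: k_def)
      moreover have "k f s \<le> k f t" using elim by (intro max) auto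
      ultimately show ?case by simp
    qed
    then obtain a where a: "a > 0" "\<And>s. dist s t < a \<Longrightarrow> (k h has_real_derivative d s) (at s) \<and> k h s \<le> k h t"
      unfolding eventually_nhds_metric by blast
    have "d t = 0"
      using DERIV_local_max[of "k h" "d t" t a] a by (auto simp: dist_real_def abs_minus_commute)
    have "(d has_real_derivative c + 2 * e) (at t)"
      unfolding d_def by (auto intro!: derivative_eq_intros h simp: algebra_simps)
    then obtain b where b: "b > 0" "\<And>s. s > 0 \<Longrightarrow> s < b \<Longrightarrow> d t < d (t + s)"
      using DERIV_pos_inc_right[of d "c + 2 * e" t] e h by auto
    define q where "q = min a b / 2"
    have q: "q > 0" "q < a" "q < b" using a b by (auto simp: q_def)
    have "k h t < k h (t + q)"
    proof (rule DERIV_pos_imp_increasing_open[where f = "k h"])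
      show "t < t + q" using q by simp
      show "\<exists>D. (k h has_real_derivative D) (at s) \<and> D > 0" if "t < s" "s < t + q" for s
        using a(2)[of s] b(2)[of "s - t"] that q \<open>d t = 0\<close> by (auto simp: dist_real_def)
      have "isCont (k h) s" if "s \<in> {t..t + q}" for s
        using a(2)[of s] that q DERIV_isCont[of "k h" "d s" s] by (auto simp: dist_real_def)
      then show "continuous_on {t..t + q} (k h)"
        by (intro continuous_at_imp_continuous_on ballI)
    qed
    with a(2)[of "t + q"] q show False by (auto simp: dist_real_def)
  qed
  also have "f x + m * (z - x) = (1 - l) * f x + l * f y"
  proof -
    have "m * (y - x) = f y - f x" using xy by (simp add: m_def)
    then have "m * (z - x) = l * (f y - f x)" unfolding zx by (simp add: mult.left_commute)
    then show ?thesis by (simp add: algebra_simps)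
  qed
  finally show "f ((1 - l) *\<^sub>R x + l *\<^sub>R y) \<le> (1 - l) * f x + l * f y"
    by (simp add: z_def)
qed

section \<open>Functions supported by orthogonal projections\<close>

definition orth_proj :: "('e::real_inner \<Rightarrow> 'e) \<Rightarrow> bool"
  where "orth_proj S \<longleftrightarrow> linear S \<and> (\<forall>x y. S x \<bullet> y = x \<bullet> S y) \<and> (\<forall>x. S (S x) = S x)"

lemma orth_proj_inner_le: "orth_proj S \<Longrightarrow> v \<bullet> S v \<le> v \<bullet> v"
proof -
  assume S: "orth_proj S"
  have "0 \<le> (v - S v) \<bullet> (v - S v)" by simp
  also have "\<dots> = v \<bullet> v - v \<bullet> S v"
  proof -
    have "S v \<bullet> S v = v \<bullet> S v" "S v \<bullet> v = v \<bullet> S v" using S by (auto simp: orth_proj_def)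
    then show ?thesis by (simp add: inner_simps)
  qed
  finally show ?thesis by simp
qed

text \<open>The quadratic form of \<open>S\<close> lies above \<open>f\<close> on \<open>U\<close> and touches it at \<open>p\<close>. With \<open>f\<close> the square of the smallest
  singular value, such an \<open>S\<close> exists at every matrix.\<close>

definition projection_support :: "('e::real_inner \<Rightarrow> real) \<Rightarrow> 'e set \<Rightarrow> 'e \<Rightarrow> ('e \<Rightarrow> 'e) \<Rightarrow> bool"
  where "projection_support f U p S \<longleftrightarrow>
    orth_proj S \<and> f p = p \<bullet> S p \<and> (\<forall>x\<in>U. f x \<le> x \<bullet> S x)"

lemma has_derivative_quadratic:
  fixes S :: "'e::euclidean_space \<Rightarrow> 'e"
  assumes "orth_proj S"
  shows "((\<lambda>x. x \<bullet> S x) has_derivative (\<lambda>v. 2 * (S p \<bullet> v))) (at p)"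
proof -
  have "bounded_linear S" using assms by (simp add: orth_proj_def linear_conv_bounded_linear)
  then have "((\<lambda>x. x \<bullet> S x) has_derivative (\<lambda>v. p \<bullet> S v + v \<bullet> S p)) (at p)"
    by (intro bounded_bilinear.FDERIV[OF bounded_bilinear_inner has_derivative_ident]
        bounded_linear_imp_has_derivative)
  moreover have "p \<bullet> S v + v \<bullet> S p = 2 * (S p \<bullet> v)" for v
    using assms by (simp add: orth_proj_def inner_commute)
  ultimately show ?thesis by simp
qed

text \<open>The difference of the quadratic form and \<open>f\<close> has a minimum at \<open>p\<close>, so \<open>S p\<close> is half of the gradient
  of \<open>f\<close>.\<close>

lemma projection_support_derivative:
  fixes f :: "'e::euclidean_space \<Rightarrow> real"
  assumes "projection_support f U p S" "open U" "p \<in> U" "f differentiable (at p)"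
  shows "(f has_derivative (\<lambda>v. 2 * (S p \<bullet> v))) (at p)"
proof -
  have S: "orth_proj S" and fp: "f p = p \<bullet> S p" and le: "\<And>x. x \<in> U \<Longrightarrow> f x \<le> x \<bullet> S x"
    using assms(1) by (auto simp: projection_support_def)
  obtain D where D: "(f has_derivative D) (at p)" using assms(4) by (auto simp: differentiable_def)
  have "(\<lambda>v. 2 * (S p \<bullet> v) - D v) = (\<lambda>v. 0)"
    by (rule differential_zero_maxmin[OF \<open>p \<in> U\<close> \<open>open U\<close>
          has_derivative_diff[OF has_derivative_quadratic[OF S] D]]) (use fp le in auto)
  then have "D = (\<lambda>v. 2 * (S p \<bullet> v))" by (auto simp: fun_eq_iff)
  with D show ?thesis by simp
qed

section \<open>Geodesics of the conformal metric at the centre of a chart\<close>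

text \<open>The reflection in the derivative is an isometry: the chart is conformal, with this factor.\<close>

lemma inner_sphere_chart_derivative:
  assumes "u \<noteq> - p"
  shows "frechet_derivative (sphere_chart p) (at u) x \<bullet> frechet_derivative (sphere_chart p) (at u) y
    = 4 * norm p ^ 4 / norm (u + p) ^ 4 * (x \<bullet> y)"
proof -
  have reflect: "(x - (2 * (w \<bullet> x) / (norm w)\<^sup>2) *\<^sub>R w) \<bullet> (y - (2 * (w \<bullet> y) / (norm w)\<^sup>2) *\<^sub>R w) = x \<bullet> y"
    if "w \<noteq> 0" for w
  proof -
    define k where "k = 2 / (norm w)\<^sup>2"
    have k: "k * (w \<bullet> w) = 2" using that by (simp add: k_def power2_norm_eq_inner)
    have "(x - (k * (w \<bullet> x)) *\<^sub>R w) \<bullet> (y - (k * (w \<bullet> y)) *\<^sub>R w)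
        = x \<bullet> y + k * (w \<bullet> x) * (w \<bullet> y) * (k * (w \<bullet> w) - 2)"
      by (simp add: inner_diff_left inner_diff_right inner_commute algebra_simps)
    then show ?thesis unfolding k by (simp add: k_def)
  qed
  have "u + p \<noteq> 0" using assms by (simp add: add_eq_0_iff2)
  have e: "frechet_derivative (sphere_chart p) (at u) = (\<lambda>x. (2 * (norm p)\<^sup>2 / (norm (u + p))\<^sup>2) *\<^sub>R
            (x - (2 * ((u + p) \<bullet> x) / (norm (u + p))\<^sup>2) *\<^sub>R (u + p)))"
    using frechet_derivative_at[OF sphere_chart_has_derivative[OF assms]] by simp
  have "(2 * (norm p)\<^sup>2 / (norm (u + p))\<^sup>2) * (2 * (norm p)\<^sup>2 / (norm (u + p))\<^sup>2)
      = 4 * norm p ^ 4 / norm (u + p) ^ 4"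
    by (simp add: power2_eq_square power4_eq_xxxx)
  then show ?thesis
    unfolding e inner_scaleR_left inner_scaleR_right reflect[OF \<open>u + p \<noteq> 0\<close>]
    by (simp only: mult.assoc[symmetric])
qed

text \<open>In the chart the metric is \<open>1 / f\<close> times the conformal factor times the Euclidean inner product. On the
  hyperplane the conformal factor is \<open>4 * norm p ^ 4 / ((norm u)\<^sup>2 + (norm p)\<^sup>2)\<^sup>2\<close>, which is stationary at the
  centre, so only the derivative of \<open>1 / f\<close> contributes.\<close>

lemma chart_metric_conformal_deriv:
  fixes p :: "'e::euclidean_space"
  assumes "p \<noteq> 0" "(f has_derivative (\<lambda>v. 2 * (G \<bullet> v))) (at p)" "f p \<noteq> 0" "p \<bullet> x = 0"
  defines "C \<equiv> chart_metric (\<lambda>x v w. 1 / f x * induced_metric x v w) (sphere_chart p)"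
  shows "((\<lambda>s. C (0 + s *\<^sub>R x) y w) has_real_derivative - 16 * (G \<bullet> x) * (y \<bullet> w) / (f p)\<^sup>2) (at 0)"
proof -
  have n: "(norm (s *\<^sub>R x + p))\<^sup>2 = s\<^sup>2 * (norm x)\<^sup>2 + (norm p)\<^sup>2" for s
    using assms(4) unfolding power2_norm_eq_inner by (simp add: inner_simps power2_eq_square inner_commute)
  have pos: "s\<^sup>2 * (norm x)\<^sup>2 + (norm p)\<^sup>2 > 0" for s
    using assms(1) by (intro add_nonneg_pos) auto
  have ne: "s *\<^sub>R x \<noteq> - p" for s
  proof
    assume "s *\<^sub>R x = - p"
    then have "norm (s *\<^sub>R x + p) = 0" by simp
    with n[of s] pos[of s] show False by simp
  qed
  have "norm (s *\<^sub>R x + p) ^ 4 = (s\<^sup>2 * (norm x)\<^sup>2 + (norm p)\<^sup>2)\<^sup>2" for s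
    unfolding n[symmetric] by (simp flip: power_mult)
  then have C: "C (0 + s *\<^sub>R x) y w =
      1 / f (sphere_chart p (s *\<^sub>R x)) * (4 * norm p ^ 4 / (s\<^sup>2 * (norm x)\<^sup>2 + (norm p)\<^sup>2)\<^sup>2 * (y \<bullet> w))" for s
    unfolding C_def chart_metric_def induced_metric_def
    by (simp add: inner_sphere_chart_derivative[OF ne])
  have s0: "sphere_chart p 0 = p" using assms(1) by (simp add: sphere_chart_def scaleR_2)
  have d0: "(sphere_chart p has_derivative (\<lambda>x. 2 *\<^sub>R (x - (2 * (p \<bullet> x) / (norm p)\<^sup>2) *\<^sub>R p))) (at (0 *\<^sub>R x))"
    using sphere_chart_has_derivative[of 0 p] assms(1) by simp
  have "((\<lambda>s. s *\<^sub>R x) has_derivative (\<lambda>s. s *\<^sub>R x)) (at 0)"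
    by (auto intro!: derivative_eq_intros)
  from has_derivative_compose[OF this d0]
  have "((\<lambda>s. sphere_chart p (s *\<^sub>R x)) has_derivative (\<lambda>s. s *\<^sub>R 2 *\<^sub>R x)) (at 0)"
    using assms(4) by (simp add: mult.commute)
  from has_derivative_compose[OF this, of f "\<lambda>v. 2 * (G \<bullet> v)"]
  have "((\<lambda>s. f (sphere_chart p (s *\<^sub>R x))) has_real_derivative 4 * (G \<bullet> x)) (at 0)"
    using assms(2) s0 by (simp add: has_field_derivative_def mult_commute_abs algebra_simps)
  note [derivative_intros] = this
  have "norm p \<noteq> 0" using assms(1) by simp
  then show ?thesis
    unfolding C using assms(3)
    by (auto intro!: derivative_eq_intros simp: s0 less_imp_neq[OF pos, symmetric] power2_eq_square power4_eq_xxxx divide_simps)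
qed

text \<open>As the conformal factor is stationary at the centre, the Christoffel symbols there only contain the
  half gradient \<open>G\<close> of \<open>f\<close>. Here \<open>v\<close> and \<open>a\<close> are the coordinate velocity and acceleration of the geodesic.\<close>

lemma geodesic_equation_at_centre:
  fixes p :: "'e::euclidean_space"
  assumes "p \<noteq> 0" "(f has_derivative (\<lambda>v. 2 * (G \<bullet> v))) (at p)" "f p \<noteq> 0"
    and "p \<bullet> v = 0" "p \<bullet> w = 0"
  defines "C \<equiv> chart_metric (\<lambda>x v w. 1 / f x * induced_metric x v w) (sphere_chart p)"
  assumes eq: "C 0 a w + christoffel C 0 v v w = 0"
  shows "f p * (a \<bullet> w) = 4 * (G \<bullet> v) * (v \<bullet> w) - 2 * (G \<bullet> w) * (v \<bullet> v)"
proof -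
  have s0: "sphere_chart p 0 = p" using assms(1) by (simp add: sphere_chart_def scaleR_2)
  have "C 0 a w = 4 * (a \<bullet> w) / f p"
    using assms(1) inner_sphere_chart_derivative[of 0 p a w]
    by (simp add: C_def chart_metric_def induced_metric_def s0)
  moreover have D: "deriv (\<lambda>s. C (0 + s *\<^sub>R x) y z) 0 = - 16 * (G \<bullet> x) * (y \<bullet> z) / (f p)\<^sup>2" if "p \<bullet> x = 0" for x y z
    using DERIV_imp_deriv[OF chart_metric_conformal_deriv[OF assms(1-3) that]] unfolding C_def .
  ultimately have "4 * (a \<bullet> w) / f p + (- 16 * (G \<bullet> v) * (v \<bullet> w) / (f p)\<^sup>2 +
      - 16 * (G \<bullet> v) * (v \<bullet> w) / (f p)\<^sup>2 - - 16 * (G \<bullet> w) * (v \<bullet> v) / (f p)\<^sup>2) / 2 = 0"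
    using eq unfolding christoffel_def D[OF assms(4)] D[OF assms(5)] by simp
  then show ?thesis
    using assms(3) by (simp add: field_simps power2_eq_square)
qed

section \<open>Self-convexity on spheres\<close>

lemma has_vector_derivative_inner:
  fixes f g :: "real \<Rightarrow> 'e::real_inner"
  assumes "(f has_vector_derivative f') (at t)" "(g has_vector_derivative g') (at t)"
  shows "((\<lambda>s. f s \<bullet> g s) has_real_derivative f t \<bullet> g' + f' \<bullet> g t) (at t)"
  using bounded_bilinear.has_vector_derivative[OF bounded_bilinear_inner assms]
  by (simp add: has_real_derivative_iff_has_vector_derivative)

lemma orthogonal_velocity:
  fixes u :: "real \<Rightarrow> 'e::real_inner"
  assumes "\<forall>\<^sub>F s in nhds t. p \<bullet> u s = 0" "(u has_vector_derivative v) (at t)"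
  shows "p \<bullet> v = 0"
proof -
  have "((\<lambda>s. p \<bullet> u s) has_real_derivative p \<bullet> v) (at t)"
    using has_vector_derivative_inner[OF has_vector_derivative_const assms(2), of p] by simp
  moreover have "((\<lambda>s. p \<bullet> u s) has_real_derivative p \<bullet> v) (at t) \<longleftrightarrow> ((\<lambda>s. 0) has_real_derivative p \<bullet> v) (at t)"
    by (rule DERIV_cong_ev[OF refl assms(1) refl])
  ultimately show ?thesis using DERIV_unique[OF _ DERIV_const] by blast
qed

text \<open>Second order expansion of the chart at its centre, along a curve whose velocity and acceleration at
  the centre are orthogonal to \<open>p\<close>. The multiple of \<open>p\<close> in the acceleration keeps the image on the sphere.\<close>

lemma sphere_chart_curve:
  fixes u :: "real \<Rightarrow> 'e::euclidean_space"
  assumes p: "p \<noteq> 0" and u: "\<forall>\<^sub>F s in nhds t. (u has_vector_derivative u' s) (at s)"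
    and u': "(u' has_vector_derivative a) (at t)"
    and ut: "u t = 0" "p \<bullet> u' t = 0" "p \<bullet> a = 0"
  obtains g' where
    "\<forall>\<^sub>F s in nhds t. ((\<lambda>s. sphere_chart p (u s)) has_vector_derivative g' s) (at s)"
    "g' t = 2 *\<^sub>R u' t"
    "(g' has_vector_derivative 2 *\<^sub>R a - (4 * (u' t \<bullet> u' t) / (norm p)\<^sup>2) *\<^sub>R p) (at t)"
proof -
  define w where "w s = u s + p" for s
  define n where "n s = w s \<bullet> w s" for s
  define m where "m s = w s \<bullet> u' s" for s
  define c where "c s = 2 * (norm p)\<^sup>2 / n s" for s
  define e where "e s = c s * (2 * m s / n s)" for s
  define g' where "g' s = c s *\<^sub>R u' s - e s *\<^sub>R w s" for s
  have R: "(norm p)\<^sup>2 \<noteq> 0" using p by simp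
  have ud: "(u has_vector_derivative u' t) (at t)" using eventually_nhds_x_imp_x[OF u] .
  have wd: "(w has_vector_derivative u' t) (at t)"
    unfolding w_def by (auto intro!: derivative_eq_intros ud)
  have wt: "w t = p" and nt: "n t = (norm p)\<^sup>2" and mt: "m t = 0"
    using ut by (simp_all add: w_def n_def m_def power2_norm_eq_inner)
  have nd: "(n has_real_derivative 0) (at t)"
    using has_vector_derivative_inner[OF wd wd] ut wt unfolding n_def by (simp add: inner_commute)
  have md: "(m has_real_derivative u' t \<bullet> u' t) (at t)"
    using has_vector_derivative_inner[OF wd u'] ut wt unfolding m_def by simp
  have cd: "(c has_real_derivative 0) (at t)"
    unfolding c_def using R nt by (auto intro!: derivative_eq_intros nd)
  have ed: "(e has_real_derivative 4 * (u' t \<bullet> u' t) / (norm p)\<^sup>2) (at t)"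
    unfolding e_def using R nt mt by (auto intro!: derivative_eq_intros nd md cd simp: c_def power2_eq_square)
  have gd: "(g' has_vector_derivative 2 *\<^sub>R a - (4 * (u' t \<bullet> u' t) / (norm p)\<^sup>2) *\<^sub>R p) (at t)"
  proof -
    have "(g' has_vector_derivative (c t *\<^sub>R a + 0 *\<^sub>R u' t)
        - (e t *\<^sub>R u' t + (4 * (u' t \<bullet> u' t) / (norm p)\<^sup>2) *\<^sub>R w t)) (at t)"
      unfolding g'_def
      by (intro has_vector_derivative_diff has_vector_derivative_scaleR cd ed u' wd)
    moreover have "c t = 2" "e t = 0" using R nt mt by (simp_all add: c_def e_def)
    ultimately show ?thesis by (simp add: wt)
  qed
  have "(u \<longlongrightarrow> u t) (nhds t)"
    using has_vector_derivative_continuous[OF ud] by (simp add: isCont_def tendsto_at_iff_tendsto_nhds)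
  then have "\<forall>\<^sub>F s in nhds t. u s \<noteq> - p"
    using ut p by (intro tendsto_imp_eventually_ne) auto
  with u have "\<forall>\<^sub>F s in nhds t. ((\<lambda>s. sphere_chart p (u s)) has_vector_derivative g' s) (at s)"
  proof eventually_elim
    case (elim s)
    define D where "D x = (2 * (norm p)\<^sup>2 / (norm (u s + p))\<^sup>2) *\<^sub>R
      (x - (2 * ((u s + p) \<bullet> x) / (norm (u s + p))\<^sup>2) *\<^sub>R (u s + p))" for x
    have D: "(sphere_chart p has_derivative D) (at (u s))"
      using sphere_chart_has_derivative[OF elim(2)] unfolding D_def .
    have "((\<lambda>s. sphere_chart p (u s)) has_derivative (\<lambda>x. D (x *\<^sub>R u' s))) (at s)"
      using has_derivative_compose[OF elim(1)[unfolded has_vector_derivative_def] D] .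
    then have "((\<lambda>s. sphere_chart p (u s)) has_vector_derivative D (u' s)) (at s)"
      unfolding has_vector_derivative_def by (simp add: linear_scale[OF has_derivative_linear[OF D]])
    then show ?case
      by (simp add: D_def w_def g'_def e_def c_def m_def n_def power2_norm_eq_inner scaleR_diff_right)
  qed
  then show ?thesis using gd nt mt R by (intro that[of g']) (auto simp: g'_def c_def e_def)
qed

text \<open>With \<open>q = \<gamma> \<bullet> S \<gamma>\<close> the second derivative of \<open>- ln q\<close> is \<open>(q'\<^sup>2 - q q'') / q\<^sup>2\<close>, where
  \<open>q' = 2 (S \<gamma> \<bullet> \<gamma>')\<close>. The hypothesis on \<open>a\<close> says that the numerator is nonnegative.\<close>

lemma neg_ln_quadratic_along_curve:
  fixes \<gamma> :: "real \<Rightarrow> 'e::euclidean_space"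
  assumes S: "orth_proj S" and d: "\<forall>\<^sub>F s in nhds t. (\<gamma> has_vector_derivative \<gamma>' s) (at s)"
    and d': "(\<gamma>' has_vector_derivative a) (at t)" and pos: "\<gamma> t \<bullet> S (\<gamma> t) > 0"
    and ineq: "(\<gamma> t \<bullet> S (\<gamma> t)) * (\<gamma>' t \<bullet> S (\<gamma>' t) + S (\<gamma> t) \<bullet> a) \<le> 2 * (S (\<gamma> t) \<bullet> \<gamma>' t)\<^sup>2"
  shows "\<exists>h' c. (\<forall>\<^sub>F s in nhds t. ((\<lambda>s. - ln (\<gamma> s \<bullet> S (\<gamma> s))) has_real_derivative h' s) (at s)) \<and>
    (h' has_real_derivative c) (at t) \<and> c \<ge> 0"
proof -
  have bl: "bounded_linear S" and sym: "S x \<bullet> y = x \<bullet> S y" for x y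
    using S by (auto simp: orth_proj_def linear_conv_bounded_linear)
  define q where "q s = \<gamma> s \<bullet> S (\<gamma> s)" for s
  define m where "m s = S (\<gamma> s) \<bullet> \<gamma>' s" for s
  have Sd: "((\<lambda>s. S (\<gamma> s)) has_vector_derivative S (\<gamma>' s)) (at s)"
    if "(\<gamma> has_vector_derivative \<gamma>' s) (at s)" for s
    using bounded_linear.has_vector_derivative[OF bl that] .
  have qd: "(q has_real_derivative 2 * m s) (at s)" if "(\<gamma> has_vector_derivative \<gamma>' s) (at s)" for s
    using has_vector_derivative_inner[OF that Sd[OF that]] sym[of "\<gamma> s" "\<gamma>' s"]
    unfolding q_def m_def by (simp add: inner_commute)
  note dt = eventually_nhds_x_imp_x[OF d]
  have md: "(m has_real_derivative S (\<gamma> t) \<bullet> a + \<gamma>' t \<bullet> S (\<gamma>' t)) (at t)"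
    using has_vector_derivative_inner[OF Sd[OF dt] d'] unfolding m_def by (simp add: inner_commute)
  define h' where "h' s = - (2 * m s) / q s" for s
  have "(q \<longlongrightarrow> q t) (nhds t)"
    using DERIV_isCont[OF qd[OF dt]] by (simp only: isCont_def tendsto_at_iff_tendsto_nhds)
  then have "\<forall>\<^sub>F s in nhds t. q s > 0"
    by (rule order_tendstoD(1)) (use pos in \<open>simp add: q_def\<close>)
  with d have "\<forall>\<^sub>F s in nhds t. ((\<lambda>s. - ln (q s)) has_real_derivative h' s) (at s)"
  proof eventually_elim
    case (elim s)
    show ?case
      unfolding h'_def using elim(2) by (auto intro!: derivative_eq_intros qd[OF elim(1)])
  qed
  moreover
  define c where "c = (4 * (m t)\<^sup>2 - 2 * (q t * (\<gamma>' t \<bullet> S (\<gamma>' t) + S (\<gamma> t) \<bullet> a))) / (q t)\<^sup>2"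
  have "(h' has_real_derivative c) (at t)"
    unfolding h'_def c_def using pos
    by (auto intro!: derivative_eq_intros qd[OF dt] md
        simp: q_def[symmetric] field_simps power2_eq_square)
  moreover have "c \<ge> 0" using ineq unfolding c_def q_def m_def by simp
  ultimately show ?thesis unfolding q_def by blast
qed

text \<open>At a point \<open>p = \<gamma> t\<close> of a geodesic, \<open>- ln q\<close> with the quadratic form \<open>q\<close> of a supporting projection is a lower
  support function of \<open>ln (1 / f)\<close>. In the chart centred at \<open>p\<close> the geodesic equation, tested with the
  tangential part \<open>w\<close> of \<open>S p\<close>, yields \<open>q q'' = q'\<^sup>2 + 8 q (v \<bullet> S v - v \<bullet> v)\<close> at \<open>t\<close>, and a projection does
  not lengthen \<open>v\<close>. The two terms that the curvature of the sphere produces, one in the geodesic equation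
  and one in the acceleration of the curve, cancel because \<open>q\<close> is homogeneous of degree two.\<close>

theorem self_convex_sphere:
  fixes U :: "'e::euclidean_space set"
  assumes U: "open U" and r: "r > 0" and C2: "Ck_on 2 U f"
    and pos: "\<And>x. x \<in> U \<Longrightarrow> f x > 0"
    and supp: "\<And>p. p \<in> U \<Longrightarrow> \<exists>S. projection_support f U p S"
  shows "self_convex {x \<in> U. norm x = r} induced_metric (\<lambda>x. 1 / f x)"
  unfolding self_convex_def
proof (intro conjI allI impI ballI)
  let ?M = "{x \<in> U. norm x = r}"
  show "submanifold ?M" by (rule submanifold_sphere[OF U r])
  have "Ck_on 2 U (\<lambda>x. 1 / f x)"
    using Ck_on_inverse[OF U C2] pos by (auto simp: inverse_eq_divide less_imp_neq[symmetric])
  with U show "Ck_on_submanifold 2 ?M (\<lambda>x. 1 / f x)"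
    unfolding Ck_on_submanifold_def by blast
  show "0 < 1 / f x" if "x \<in> ?M" for x using pos that by simp
  have diff: "f differentiable (at x)" if "x \<in> U" for x
    using C2 that by (simp add: numeral_2_eq_2)
  fix I \<gamma>
  assume geo: "geodesic ?M (\<lambda>x v w. 1 / f x * induced_metric x v w) I \<gamma>"
  then have I: "is_interval I" and M: "\<And>t. t \<in> I \<Longrightarrow> \<gamma> t \<in> U \<and> norm (\<gamma> t) = r"
    and cont: "continuous_on I \<gamma>"
    by (auto simp: geodesic_def)
  show "convex_on I (\<lambda>t. ln (1 / f (\<gamma> t)))"
  proof (rule convex_on_if_lower_support[OF I])
    have "continuous_on I (\<lambda>t. f (\<gamma> t))"
      using M by (intro continuous_on_compose2[OF Ck_on_imp_continuous_on[OF C2] cont]) auto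
    moreover have "f (\<gamma> t) > 0" if "t \<in> I" for t using M[OF that] pos by blast
    ultimately show "continuous_on I (\<lambda>t. ln (1 / f (\<gamma> t)))"
      by (intro continuous_intros) (auto simp: less_imp_neq[symmetric])
  next
    fix t assume t: "t \<in> interior I"
    then have tI: "t \<in> I" using interior_subset by blast
    define p where "p = \<gamma> t"
    have pU: "p \<in> U" and pr: "norm p = r" using M[OF tI] by (auto simp: p_def)
    have p0: "p \<noteq> 0" using pr r by auto
    obtain S where sup: "projection_support f U p S" using supp[OF pU] by blast
    then have S: "orth_proj S" and fp: "f p = p \<bullet> S p" and le: "\<And>x. x \<in> U \<Longrightarrow> f x \<le> x \<bullet> S x"
      by (auto simp: projection_support_def)
    note fd = projection_support_derivative[OF sup U pU diff[OF pU]]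
    define \<psi> where "\<psi> = sphere_chart p"
    define u where "u s = \<psi> (\<gamma> s)" for s
    let ?V = "{v. p \<bullet> v = 0}" and ?g = "\<lambda>x v w. 1 / f x * induced_metric x v w"
    define \<Omega> where "\<Omega> = \<psi> ` (U - {- p})"
    have slice: "slice_chart ?M ?V \<Omega> \<psi> \<psi>" and img: "\<psi> ` \<Omega> = U - {- p}"
      unfolding \<psi>_def \<Omega>_def by (rule slice_chart_sphere[OF U pU pr r])+
    from geo[unfolded geodesic_def, THEN conjunct2, THEN conjunct2, THEN conjunct2,
        THEN spec[of _ ?V], THEN spec[of _ \<Omega>], THEN spec[of _ \<psi>], THEN spec[of _ \<psi>], THEN mp, OF slice]
    obtain u' u'' where eq: "\<forall>s\<in>I. \<gamma> s \<in> \<psi> ` \<Omega> \<longrightarrow>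
        ((\<lambda>s. \<psi> (\<gamma> s)) has_vector_derivative u' s) (at s within I) \<and>
        (u' has_vector_derivative u'' s) (at s within I) \<and>
        (\<forall>w\<in>?V. chart_metric ?g \<psi> (\<psi> (\<gamma> s)) (u'' s) w
           + christoffel (chart_metric ?g \<psi>) (\<psi> (\<gamma> s)) (u' s) (u' s) w = 0)"
      by (elim exE) (rule that)
    have eq: "(u has_vector_derivative u' s) (at s within I)"
        "(u' has_vector_derivative u'' s) (at s within I)"
        "\<And>w. p \<bullet> w = 0 \<Longrightarrow> chart_metric ?g \<psi> (u s) (u'' s) w
           + christoffel (chart_metric ?g \<psi>) (u s) (u' s) (u' s) w = 0"
      if "s \<in> I" "\<gamma> s \<in> U - {- p}" for s
      using eq[rule_format, OF that(1), unfolded img, OF that(2)]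
      unfolding u_def by (auto simp only: mem_Collect_eq)
    have ev: "\<forall>\<^sub>F s in nhds t. s \<in> interior I \<and> \<gamma> s \<in> U - {- p}"
    proof -
      have "(\<gamma> \<longlongrightarrow> p) (nhds t)"
        using continuous_on_interior[OF cont t]
        unfolding p_def isCont_def tendsto_at_iff_tendsto_nhds .
      moreover have "p \<noteq> - p" using p0 by (simp add: eq_neg_iff_add_eq_0 flip: scaleR_2)
      ultimately have "\<forall>\<^sub>F s in nhds t. \<gamma> s \<noteq> - p" by (rule tendsto_imp_eventually_ne)
      moreover have "\<forall>\<^sub>F s in nhds t. s \<in> interior I"
        using t by (intro eventually_nhds_in_open) auto
      ultimately show ?thesis
        by eventually_elim (use M interior_subset in blast)
    qed
    have ud: "\<forall>\<^sub>F s in nhds t. (u has_vector_derivative u' s) (at s)"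
      using ev
    proof eventually_elim
      case (elim s)
      then have "s \<in> interior I" "s \<in> I" "\<gamma> s \<in> U - {- p}" using interior_subset by blast+
      then show ?case using eq(1)[of s] by (simp only: at_within_interior)
    qed
    have up: "\<forall>\<^sub>F s in nhds t. p \<bullet> u s = 0 \<and> \<psi> (u s) = \<gamma> s"
      using ev
    proof eventually_elim
      case (elim s)
      then have "s \<in> I" using interior_subset by blast
      with elim have "\<gamma> s \<noteq> - p" "norm (\<gamma> s) = norm p" using M[of s] pr by simp_all
      moreover have "\<psi> (u s) = \<gamma> s" "u s \<noteq> - p"
        unfolding u_def \<psi>_def using calculation(1) p0
        by (rule sphere_chart_involution[rotated] sphere_chart_neq[rotated])+
      ultimately show ?case
        using norm_sphere_chart[OF p0, of "u s"] unfolding \<psi>_def by metis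
    qed
    \<comment> \<open>\<open>u\<close> stays in the hyperplane near \<open>t\<close>, hence so do its velocity and, at \<open>t\<close>, its acceleration.\<close>
    have u'p: "\<forall>\<^sub>F s in nhds t. p \<bullet> u' s = 0"
    proof -
      have "\<forall>\<^sub>F s in nhds t. \<forall>\<^sub>F s in nhds s. p \<bullet> u s = 0"
        unfolding eventually_eventually using up by (rule eventually_mono) simp
      with ud show ?thesis by eventually_elim (rule orthogonal_velocity)
    qed
    have ut: "u t = 0"
      using p0 by (simp add: u_def \<psi>_def p_def[symmetric] sphere_chart_def power2_norm_eq_inner inner_simps
          flip: scaleR_2)
    define v a where "v = u' t" and "a = u'' t"
    have tmem: "\<gamma> t \<in> U - {- p}" using eventually_nhds_x_imp_x[OF ev] by blast
    have u'd: "(u' has_vector_derivative a) (at t)"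
      using eq(2)[OF tI tmem] unfolding a_def at_within_interior[OF t] .
    have pv: "p \<bullet> v = 0" using eventually_nhds_x_imp_x[OF u'p] by (simp add: v_def)
    have pa: "p \<bullet> a = 0" by (rule orthogonal_velocity[OF u'p u'd])
    obtain g' where g: "\<forall>\<^sub>F s in nhds t. ((\<lambda>s. \<psi> (u s)) has_vector_derivative g' s) (at s)"
      and gt: "g' t = 2 *\<^sub>R v"
      and g'd: "(g' has_vector_derivative 2 *\<^sub>R a - (4 * (v \<bullet> v) / (norm p)\<^sup>2) *\<^sub>R p) (at t)"
      using sphere_chart_curve[OF p0 ud u'd ut] pv pa unfolding v_def \<psi>_def by blast
    define R where "R = (norm p)\<^sup>2"
    define L where "L = f p"
    have R: "R > 0" using p0 by (simp add: R_def)
    have L: "L > 0" using pos[OF pU] by (simp add: L_def)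
    have Gp: "S p \<bullet> p = L" using fp by (simp add: L_def inner_commute)
    have GG: "S p \<bullet> S p = L" using S fp by (simp add: orth_proj_def L_def)
    \<comment> \<open>the component of the half gradient \<open>S p\<close> tangent to the sphere\<close>
    define w where "w = S p - (L / R) *\<^sub>R p"
    have pw: "p \<bullet> w = 0"
      using Gp R by (simp add: w_def inner_simps inner_commute R_def power2_norm_eq_inner)
    have xw: "x \<bullet> w = S p \<bullet> x" if "p \<bullet> x = 0" for x
      using that by (simp add: w_def inner_simps inner_commute)
    have Gw: "S p \<bullet> w = L - L\<^sup>2 / R"
      using Gp GG by (simp add: w_def inner_simps power2_eq_square)
    have geq: "L * (S p \<bullet> a) = 4 * (S p \<bullet> v)\<^sup>2 - 2 * (L - L\<^sup>2 / R) * (v \<bullet> v)"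
    proof -
      have "chart_metric ?g \<psi> 0 a w + christoffel (chart_metric ?g \<psi>) 0 v v w = 0"
        using eq(3)[OF tI tmem pw] by (simp add: ut v_def a_def)
      from geodesic_equation_at_centre[OF p0 fd _ pv pw this[unfolded \<psi>_def]] L
      show ?thesis by (simp add: L_def[symmetric] xw[OF pa] xw[OF pv] Gw power2_eq_square)
    qed
    have \<gamma>\<psi>: "\<psi> (u t) = p" using eventually_nhds_x_imp_x[OF up] by (simp add: p_def)
    have "\<exists>h' c. (\<forall>\<^sub>F s in nhds t. ((\<lambda>s. - ln (\<psi> (u s) \<bullet> S (\<psi> (u s)))) has_real_derivative h' s) (at s)) \<and>
        (h' has_real_derivative c) (at t) \<and> c \<ge> 0"
    proof (rule neg_ln_quadratic_along_curve[OF S g g'd])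
      show "\<psi> (u t) \<bullet> S (\<psi> (u t)) > 0" using L fp by (simp add: \<gamma>\<psi> L_def)
      have S2: "S (2 *\<^sub>R v) = 2 *\<^sub>R S v" using S by (simp add: orth_proj_def linear_scale)
      have "L * (4 * (v \<bullet> S v) + 2 * (S p \<bullet> a) - 4 * (v \<bullet> v) / R * L)
          = 4 * L * (v \<bullet> S v) + 2 * (L * (S p \<bullet> a)) - 4 * (L\<^sup>2 / R) * (v \<bullet> v)"
        by (simp add: right_diff_distrib distrib_left power2_eq_square)
      also have "\<dots> = 8 * (S p \<bullet> v)\<^sup>2 + 4 * L * (v \<bullet> S v - v \<bullet> v)"
        unfolding geq by (simp add: left_diff_distrib right_diff_distrib)
      also have "\<dots> \<le> 8 * (S p \<bullet> v)\<^sup>2"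
        using orth_proj_inner_le[OF S, of v] L by (simp add: mult_nonneg_nonpos)
      finally show "(\<psi> (u t) \<bullet> S (\<psi> (u t))) * (g' t \<bullet> S (g' t)
          + S (\<psi> (u t)) \<bullet> (2 *\<^sub>R a - (4 * (v \<bullet> v) / (norm p)\<^sup>2) *\<^sub>R p)) \<le> 2 * (S (\<psi> (u t)) \<bullet> g' t)\<^sup>2"
        unfolding \<gamma>\<psi> gt S2 R_def[symmetric] fp[symmetric] L_def[symmetric]
        by (simp add: inner_simps Gp power_mult_distrib algebra_simps)
    qed
    then obtain h' c where h: "\<forall>\<^sub>F s in nhds t. ((\<lambda>s. - ln (\<psi> (u s) \<bullet> S (\<psi> (u s)))) has_real_derivative h' s) (at s)"
      "(h' has_real_derivative c) (at t)" "c \<ge> 0" by blast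
    have "\<forall>\<^sub>F s in nhds t. - ln (\<psi> (u s) \<bullet> S (\<psi> (u s))) \<le> ln (1 / f (\<gamma> s))"
      using up ev
    proof eventually_elim
      case (elim s)
      have "0 < f (\<gamma> s)" "f (\<gamma> s) \<le> \<gamma> s \<bullet> S (\<gamma> s)" using elim pos le by auto
      then show ?case using elim by (simp add: ln_div)
    qed
    moreover have "- ln (\<psi> (u t) \<bullet> S (\<psi> (u t))) = ln (1 / f (\<gamma> t))"
      using L fp unfolding \<gamma>\<psi> by (simp add: ln_div L_def p_def)
    ultimately show "\<exists>h h' c. h t = ln (1 / f (\<gamma> t)) \<and> (\<forall>\<^sub>F s in nhds t. h s \<le> ln (1 / f (\<gamma> s))) \<and>
        (\<forall>\<^sub>F s in nhds t. (h has_real_derivative h' s) (at s)) \<and>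
        (h' has_real_derivative c) (at t) \<and> c \<ge> 0"
      using h by (intro exI[of _ "\<lambda>s. - ln (\<psi> (u s) \<bullet> S (\<psi> (u s)))"] exI[of _ h'] exI[of _ c] conjI)
  qed
qed

section \<open>Smooth dependence of simple roots\<close>

text \<open>As \<open>g\<close> vanishes at \<open>x\<close>, it is of first order there, and the variation of the continuous factor \<open>h\<close> only
  enters multiplied by it.\<close>

lemma has_derivative_mult_zero:
  fixes g h :: "'e::real_normed_vector \<Rightarrow> 'k::real_normed_field"
  assumes g: "(g has_derivative g') (at x)" "g x = 0" and h: "isCont h x"
  shows "((\<lambda>y. g y * h y) has_derivative (\<lambda>v. g' v * h x)) (at x)"
proof -
  have bl: "bounded_linear g'" using g(1) by (rule has_derivative_bounded_linear)
  obtain K where K: "\<And>v. norm (g' v) \<le> norm v * K" using bounded_linear.bounded[OF bl] by blast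
  have hx: "((\<lambda>y. h y) \<longlongrightarrow> h x) (at x)" using h by (simp add: isCont_def)
  have "((\<lambda>y. (g y - g x - g' (y - x)) /\<^sub>R norm (y - x)) \<longlongrightarrow> 0) (at x)"
    using g(1) by (simp add: has_derivative_at_within)
  from tendsto_mult[OF this hx]
  have 1: "((\<lambda>y. (g y - g' (y - x)) /\<^sub>R norm (y - x) * h y) \<longlongrightarrow> 0) (at x)"
    by (simp add: g(2))
  have "((\<lambda>y. h y - h x) \<longlongrightarrow> 0) (at x)" using hx by (simp add: LIM_zero_iff)
  then have "((\<lambda>y. \<bar>K\<bar> * norm (h y - h x)) \<longlongrightarrow> 0) (at x)"
    by (intro tendsto_mult_right_zero tendsto_norm_zero)
  moreover have "norm (g' (y - x) /\<^sub>R norm (y - x) * (h y - h x)) \<le> \<bar>K\<bar> * norm (h y - h x)" for y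
  proof (cases "y = x")
    case False
    have "norm (g' (y - x)) \<le> norm (y - x) * \<bar>K\<bar>"
      by (rule order_trans[OF K mult_left_mono]) auto
    then have "norm (g' (y - x) /\<^sub>R norm (y - x)) \<le> \<bar>K\<bar>"
      using False by (simp add: divide_simps mult.commute)
    then show ?thesis by (simp only: norm_mult mult_right_mono norm_ge_zero)
  qed simp
  ultimately have 2: "((\<lambda>y. g' (y - x) /\<^sub>R norm (y - x) * (h y - h x)) \<longlongrightarrow> 0) (at x)"
    by (metis (no_types, lifting) Lim_null_comparison always_eventually)
  have split: "(g y - g' (y - x)) /\<^sub>R norm (y - x) * h y + g' (y - x) /\<^sub>R norm (y - x) * (h y - h x)
      = (g y * h y - g x * h x - g' (y - x) * h x) /\<^sub>R norm (y - x)" for y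
  proof -
    have "(a - b) * c + b * (c - d) = a * c - 0 * d - b * d" for a b c d :: 'k
      by (simp add: left_diff_distrib right_diff_distrib)
    then show ?thesis
      by (simp only: mult_scaleR_left scaleR_add_right[symmetric] g(2))
  qed
  have "((\<lambda>y. (g y * h y - g x * h x - g' (y - x) * h x) /\<^sub>R norm (y - x)) \<longlongrightarrow> 0) (at x)"
    using tendsto_add[OF 1 2] by (simp only: split add_0_right)
  moreover have "bounded_linear (\<lambda>v. g' v * h x)"
    by (rule bounded_linear_compose[OF bounded_linear_mult_left bl])
  ultimately show ?thesis unfolding has_derivative_at_within by (intro conjI)
qed

lemma poly_eq_sum_le:
  fixes p :: "'a::comm_semiring_1 poly"
  assumes "degree p \<le> n"
  shows "poly p z = (\<Sum>i\<le>n. coeff p i * z ^ i)"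
  unfolding poly_altdef
  by (rule sum.mono_neutral_left) (use assms coeff_eq_0[of p] in auto)

lemma poly_pderiv_eq_sum_le:
  fixes p :: "'a::{comm_semiring_1,semiring_no_zero_divisors} poly"
  assumes "degree p \<le> n"
  shows "poly (pderiv p) z = (\<Sum>i\<le>n. coeff p i * (of_nat i * z ^ (i - 1)))"
proof -
  have "coeff p (Suc n) = 0" using assms by (intro coeff_eq_0) simp
  moreover have "degree (pderiv p) \<le> n"
    using assms by (intro degree_le) (simp add: coeff_pderiv coeff_eq_0)
  then have "poly (pderiv p) z = (\<Sum>i<Suc n. of_nat (Suc i) * coeff p (Suc i) * z ^ i)"
    by (simp only: poly_eq_sum_le coeff_pderiv lessThan_Suc_atMost)
  ultimately have "poly (pderiv p) z = (\<Sum>i<n. of_nat (Suc i) * coeff p (Suc i) * z ^ i)"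
    by (simp only: sum.lessThan_Suc mult_zero_right mult_zero_left add_0_right)
  also have "\<dots> = (\<Sum>i\<le>n. coeff p i * (of_nat i * z ^ (i - 1)))"
    unfolding sum.atMost_shift by (simp add: mult_ac)
  finally show ?thesis .
qed

text \<open>Implicit differentiation of a simple root. The divided difference \<open>q x\<close> of the polynomial \<open>p x\<close>
  between \<open>F A\<close> and \<open>F x\<close> gives \<open>F x - F A = - poly (p x) (F A) / q x\<close>. Here \<open>q\<close> is only known to be continuous,
  but the numerator is differentiable and vanishes at \<open>A\<close>.\<close>

lemma root_has_derivative:
  fixes p :: "'e::euclidean_space \<Rightarrow> 'k::real_normed_field poly"
  assumes U: "open U" "A \<in> U" and deg: "\<And>x. degree (p x) \<le> n"
    and c: "\<And>i. ((\<lambda>x. coeff (p x) i) has_derivative c' i) (at A)"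
    and F: "isCont F A" "\<And>x. x \<in> U \<Longrightarrow> poly (p x) (F x) = 0"
    and simple: "poly (pderiv (p A)) (F A) \<noteq> 0"
  shows "(F has_derivative (\<lambda>v. (\<Sum>i\<le>n. c' i v * F A ^ i) * - inverse (poly (pderiv (p A)) (F A)))) (at A)"
proof -
  define q where "q x = (\<Sum>i\<le>n. coeff (p x) i * (\<Sum>j<i. F A ^ (i - Suc j) * F x ^ j))" for x
  define g where "g x = poly (p x) (F A)" for x
  have gA: "g A = 0" using F(2) U by (simp add: g_def)
  have gd: "(g has_derivative (\<lambda>v. \<Sum>i\<le>n. c' i v * F A ^ i)) (at A)"
    unfolding g_def poly_eq_sum_le[OF deg] by (intro has_derivative_sum has_derivative_mult_left c)
  have contc: "isCont (\<lambda>x. coeff (p x) i) A" for i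
    using has_derivative_continuous[OF c] by simp
  have qc: "isCont q A" unfolding q_def by (intro continuous_intros contc F(1))
  have qA: "q A = poly (pderiv (p A)) (F A)"
    unfolding q_def poly_pderiv_eq_sum_le[OF deg]
  proof (intro sum.cong refl arg_cong2[where f = "(*)"])
    fix i
    have "(\<Sum>j<i. F A ^ (i - Suc j) * F A ^ j) = (\<Sum>j<i. F A ^ (i - 1))"
      by (intro sum.cong refl) (simp flip: power_add)
    then show "(\<Sum>j<i. F A ^ (i - Suc j) * F A ^ j) = of_nat i * F A ^ (i - 1)" by simp
  qed
  have key: "(F x - F A) * q x = - g x" if "x \<in> U" for x
  proof -
    have "poly (p x) (F x) - poly (p x) (F A) = (\<Sum>i\<le>n. coeff (p x) i * (F x ^ i - F A ^ i))"
      unfolding poly_eq_sum_le[OF deg] by (simp add: sum_subtractf right_diff_distrib)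
    also have "\<dots> = (F x - F A) * q x"
      unfolding q_def sum_distrib_left power_diff_sumr2 by (simp add: mult_ac)
    finally show ?thesis using F(2)[OF that] by (simp add: g_def)
  qed
  have "((\<lambda>x. g x * - inverse (q x) + F A) has_derivative
      (\<lambda>v. (\<Sum>i\<le>n. c' i v * F A ^ i) * - inverse (q A) + 0)) (at A)"
    by (intro has_derivative_add has_derivative_mult_zero gd gA continuous_intros qc has_derivative_const)
      (use qA simple in auto)
  moreover have "\<forall>\<^sub>F x in nhds A. g x * - inverse (q x) + F A = F x"
  proof -
    have "(q \<longlongrightarrow> q A) (nhds A)"
      using qc by (simp only: isCont_def tendsto_at_iff_tendsto_nhds)
    then have "\<forall>\<^sub>F x in nhds A. q x \<noteq> 0"
      by (rule tendsto_imp_eventually_ne) (use qA simple in simp)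
    moreover have "\<forall>\<^sub>F x in nhds A. x \<in> U" using U by (rule eventually_nhds_in_open)
    ultimately show ?thesis
    proof eventually_elim
      case (elim x)
      have "F x - F A = ((F x - F A) * q x) * inverse (q x)" using elim(1) by simp
      then have "F x - F A = g x * - inverse (q x)" unfolding key[OF elim(2)] by simp
      then show ?case by (metis diff_add_cancel)
    qed
  qed
  then have "\<forall>\<^sub>F x in at A. g x * - inverse (q x) + F A = F x"
      "g A * - inverse (q A) + F A = F A"
    using eventually_nhds_conv_at by (blast, simp add: gA)
  ultimately have "(F has_derivative (\<lambda>v. (\<Sum>i\<le>n. c' i v * F A ^ i) * - inverse (q A) + 0)) (at A)"
    by (rule has_derivative_transform_eventually) simp
  then show ?thesis unfolding qA by simp
qed

text \<open>The derivative of the root is a rational expression in the root, the coefficients and their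
  derivatives, so each degree of smoothness of the root gives the next one.\<close>

lemma Ck_on_simple_root:
  fixes p :: "'e::euclidean_space \<Rightarrow> 'k::real_normed_field poly"
  assumes U: "open U" and deg: "\<And>x. degree (p x) \<le> n"
    and c: "\<And>i k. Ck_on k U (\<lambda>x. coeff (p x) i)"
    and F: "continuous_on U F" "\<And>x. x \<in> U \<Longrightarrow> poly (p x) (F x) = 0"
    and simple: "\<And>x. x \<in> U \<Longrightarrow> poly (pderiv (p x)) (F x) \<noteq> 0"
  shows "Ck_on k U F"
proof (induction k)
  case 0
  then show ?case using F by simp
next
  case (Suc k)
  let ?c = "\<lambda>i x. frechet_derivative (\<lambda>x. coeff (p x) i) (at x)"
  have c1: "Ck_on k U (\<lambda>x. ?c i x v)" for i v
    using c[of "Suc k" i] by simp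
  have "Ck_on k U (\<lambda>x. poly (pderiv (p x)) (F x))"
    unfolding poly_pderiv_eq_sum_le[OF deg]
    by (intro Ck_on_sum Ck_on_mult Ck_on_power Ck_on_const U c Suc)
  then have "Ck_on k U (\<lambda>x. (\<Sum>i\<le>n. ?c i x v * F x ^ i) * (- 1 * inverse (poly (pderiv (p x)) (F x))))" for v
    by (intro Ck_on_sum Ck_on_mult Ck_on_power Ck_on_const Ck_on_inverse U c1 Suc simple)
  moreover have "(F has_derivative (\<lambda>v. (\<Sum>i\<le>n. ?c i x v * F x ^ i) * - inverse (poly (pderiv (p x)) (F x)))) (at x)"
    if "x \<in> U" for x
    using that F(1) U
    by (intro root_has_derivative[OF U that deg] Ck_on_Suc_has_derivative[OF c] F(2) simple)
      (auto simp: continuous_on_eq_continuous_at)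
  ultimately show ?case by (intro Ck_on_has_derivI[OF U]) simp_all
qed

section \<open>Real and complex scalars\<close>

text \<open>The two properties shared by the real and the complex numbers that make a Gram matrix \<open>A A\<^sup>*\<close> self-adjoint
  for the real inner product and its eigenvalues real.\<close>

class rc_field = conjugatable_field + real_normed_field + euclidean_space +
  assumes inner_mult_conjugate: "(a * b) \<bullet> c = b \<bullet> (conjugate a * c)"
    and self_conjugate_real: "conjugate a = a \<Longrightarrow> \<exists>t. a = t *\<^sub>R 1"

instance real :: rc_field
  by standard auto

instance complex :: rc_field
proof
  fix a b c :: complex
  show "(a * b) \<bullet> c = b \<bullet> (conjugate a * c)"
    by (simp add: inner_complex_def algebra_simps)
  show "\<exists>t. a = t *\<^sub>R 1" if "conjugate a = a"
    using that by (intro exI[of _ "Re a"]) (simp add: complex_eq_iff)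
qed

lemma conjugate_of_real [simp]: "conjugate (of_real t :: 'k::rc_field) = of_real t"
proof -
  have "b \<bullet> (conjugate (of_real t) - of_real t :: 'k) = 0" for b :: 'k
  proof -
    have "b \<bullet> conjugate (of_real t :: 'k) = (of_real t * b) \<bullet> 1"
      using inner_mult_conjugate[of "of_real t" b 1] by simp
    also have "\<dots> = b \<bullet> of_real t" by (simp add: scaleR_conv_of_real[symmetric] of_real_def)
    finally show ?thesis by (simp add: inner_diff_right)
  qed
  from this[of "conjugate (of_real t) - of_real t"] show ?thesis by simp
qed

lemma conjugate_one [simp]: "conjugate (1 :: 'k::rc_field) = 1"
  using conjugate_of_real[of 1] by simp

lemma linear_conjugate: "linear (conjugate :: 'k::rc_field \<Rightarrow> 'k)"
  by (intro linearI) (simp_all add: conjugate_dist_add conjugate_dist_mul scaleR_conv_of_real)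

lemma conjugate_mult_self: "conjugate x * x = of_real ((norm (x::'k::rc_field))\<^sup>2)"
proof -
  have "conjugate (conjugate x * x) = conjugate x * x" by (simp add: conjugate_dist_mul mult.commute)
  then obtain t where t: "conjugate x * x = of_real t"
    using self_conjugate_real unfolding of_real_def by blast
  have "x \<bullet> x = 1 \<bullet> (conjugate x * x)" using inner_mult_conjugate[of x 1 x] by simp
  also have "\<dots> = t" unfolding t by (simp add: of_real_def power2_norm_eq_inner[symmetric])
  finally show ?thesis unfolding t by (simp add: power2_norm_eq_inner)
qed

lemma norm_conjugate [simp]: "norm (conjugate (x::'k::rc_field)) = norm x"
proof (cases "x = 0")
  case False
  have "norm (conjugate x) * norm x = norm x * norm x"
    unfolding norm_mult[symmetric] conjugate_mult_self by (simp add: norm_mult power2_eq_square)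
  with False show ?thesis by simp
qed simp

section \<open>Matrices and their adjoints\<close>

lemma conj_transpose_nth [simp]: "conj_transpose A $ i $ j = conjugate (A $ j $ i)"
  by (simp add: conj_transpose_def)

lemma inner_adjoint:
  fixes A :: "'k::rc_field^'m^'n"
  shows "(A *v z) \<bullet> h = z \<bullet> (conj_transpose A *v h)"
proof -
  have "(A *v z) \<bullet> h = (\<Sum>i\<in>UNIV. \<Sum>j\<in>UNIV. z $ j \<bullet> (conjugate (A $ i $ j) * h $ i))"
    by (simp add: inner_vec_def matrix_vector_mult_def inner_sum_left inner_mult_conjugate)
  also have "\<dots> = z \<bullet> (conj_transpose A *v h)"
    by (subst sum.swap) (simp add: inner_vec_def matrix_vector_mult_def inner_sum_right)
  finally show ?thesis .
qed

lemma inner_gram: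
  fixes A :: "'k::rc_field^'m^'n"
  shows "((A ** conj_transpose A) *v x) \<bullet> y = (conj_transpose A *v x) \<bullet> (conj_transpose A *v y)"
  by (simp add: matrix_vector_mul_assoc[symmetric] inner_adjoint)

lemma vector_smult_of_real: "(of_real t :: 'k::real_algebra_1) *s x = t *\<^sub>R x"
  by (simp add: vec_eq_iff) (simp add: scaleR_conv_of_real)

text \<open>The map \<open>B \<mapsto> x x\<^sup>* B\<close>. For a unit vector \<open>x\<close> it is the orthogonal projection onto the matrices all of whose
  columns are multiples of \<open>x\<close>.\<close>

definition row_proj :: "'k::rc_field^'n \<Rightarrow> 'k^'m^'n \<Rightarrow> 'k^'m^'n"
  where "row_proj x B = (\<chi> i j. x $ i * (\<Sum>k\<in>UNIV. conjugate (x $ k) * B $ k $ j))"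

lemma inner_row_proj:
  fixes B C :: "'k::rc_field^'m^'n"
  shows "row_proj x B \<bullet> C =
    (\<Sum>j\<in>UNIV. (\<Sum>k\<in>UNIV. conjugate (x $ k) * B $ k $ j) \<bullet> (\<Sum>k\<in>UNIV. conjugate (x $ k) * C $ k $ j))"
proof -
  have "row_proj x B \<bullet> C =
      (\<Sum>j\<in>UNIV. \<Sum>i\<in>UNIV. (\<Sum>k\<in>UNIV. conjugate (x $ k) * B $ k $ j) \<bullet> (conjugate (x $ i) * C $ i $ j))"
    unfolding inner_vec_def row_proj_def by (subst sum.swap) (simp add: inner_mult_conjugate)
  then show ?thesis by (simp add: inner_sum_right)
qed

lemma orth_proj_row_proj:
  fixes x :: "'k::rc_field^'n"
  assumes "norm x = 1"
  shows "orth_proj (row_proj x :: 'k^'m^'n \<Rightarrow> 'k^'m^'n)"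
  unfolding orth_proj_def
proof (intro conjI allI)
  show "linear (row_proj x :: 'k^'m^'n \<Rightarrow> 'k^'m^'n)"
    by (intro linearI)
      (simp_all add: row_proj_def vec_eq_iff distrib_left sum.distrib scaleR_sum_right[symmetric])
  show "row_proj x B \<bullet> C = B \<bullet> row_proj x C" for B C :: "'k^'m^'n"
  proof -
    have "row_proj x B \<bullet> C = row_proj x C \<bullet> B"
      unfolding inner_row_proj by (intro sum.cong refl inner_commute)
    then show ?thesis by (simp add: inner_commute)
  qed
  have "(\<Sum>k\<in>UNIV. conjugate (x $ k) * x $ k) = of_real (\<Sum>k\<in>UNIV. (norm (x $ k))\<^sup>2)"
    by (simp add: conjugate_mult_self)
  also have "(\<Sum>k\<in>UNIV. (norm (x $ k))\<^sup>2) = (norm x)\<^sup>2"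
    by (simp add: power2_norm_eq_inner inner_vec_def)
  finally have 1: "(\<Sum>k\<in>UNIV. conjugate (x $ k) * x $ k) = 1" using assms by simp
  show "row_proj x (row_proj x B) = row_proj x B" for B :: "'k^'m^'n"
    unfolding vec_eq_iff
    by (simp add: row_proj_def mult.assoc[symmetric] sum_distrib_right[symmetric] 1)
qed

lemma row_proj_quadratic:
  fixes B :: "'k::rc_field^'m^'n"
  shows "B \<bullet> row_proj x B = (norm (conj_transpose B *v x))\<^sup>2"
proof -
  have n: "(norm (y::'k^'m))\<^sup>2 = (\<Sum>j\<in>UNIV. (norm (y $ j))\<^sup>2)" for y
    by (simp add: power2_norm_eq_inner inner_vec_def)
  have "(\<Sum>k\<in>UNIV. conjugate (x $ k) * B $ k $ j) = conjugate ((conj_transpose B *v x) $ j)" for j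
    by (simp add: matrix_vector_mult_def sum_conjugate conjugate_dist_mul mult.commute)
  then show ?thesis
    unfolding n by (subst inner_commute) (simp add: inner_row_proj power2_norm_eq_inner[symmetric])
qed

section \<open>The smallest eigenvalue of the Gram matrix as a minimum\<close>

text \<open>The minimum of the Rayleigh quotient of \<open>A A\<^sup>*\<close>, which is its smallest eigenvalue.\<close>

definition gram_min :: "'k::rc_field^'m^'n \<Rightarrow> real"
  where "gram_min A = (INF x\<in>sphere 0 1. (norm (conj_transpose A *v x))\<^sup>2)"

lemma gram_min_attained:
  fixes A :: "'k::rc_field^'m^'n"
  obtains x where "norm x = 1" "gram_min A = (norm (conj_transpose A *v x))\<^sup>2"
    "\<And>y. norm y = 1 \<Longrightarrow> gram_min A \<le> (norm (conj_transpose A *v y))\<^sup>2"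
proof -
  let ?f = "\<lambda>x. (norm (conj_transpose A *v x))\<^sup>2"
  have "continuous_on (sphere 0 1) ?f"
    by (intro continuous_intros linear_continuous_on matrix_vector_mul_bounded_linear)
  moreover have "sphere (0::'k^'n) 1 \<noteq> {}" by simp
  ultimately obtain x where x: "x \<in> sphere 0 1" "\<And>y. y \<in> sphere 0 1 \<Longrightarrow> ?f x \<le> ?f y"
    using continuous_attains_inf[OF compact_sphere] by metis
  have "gram_min A = ?f x"
    unfolding gram_min_def using x by (intro cInf_eq_minimum) auto
  then show ?thesis using x by (intro that[of x]) auto
qed

lemma gram_min_le:
  fixes A :: "'k::rc_field^'m^'n"
  shows "gram_min A * (norm y)\<^sup>2 \<le> (norm (conj_transpose A *v y))\<^sup>2"
proof (cases "y = 0")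
  case False
  have "norm y = 1 \<Longrightarrow> gram_min A \<le> (norm (conj_transpose A *v y))\<^sup>2" for y
    using gram_min_attained[of A] by metis
  from this[of "y /\<^sub>R norm y"] False
  have "gram_min A \<le> (norm (conj_transpose A *v (y /\<^sub>R norm y)))\<^sup>2" by simp
  also have "conj_transpose A *v (y /\<^sub>R norm y) = (conj_transpose A *v y) /\<^sub>R norm y"
    by (rule linear_cmul) (simp add: bounded_linear.linear)
  finally show ?thesis using False by (simp add: power_mult_distrib power_divide field_simps)
qed simp

lemma gram_min_nonneg: "gram_min A \<ge> 0"
  using gram_min_attained[of A] by (metis zero_le_power2)

text \<open>\<open>gram_min\<close> is a minimum of quadratic forms of projections, and a minimizing vector \<open>x\<close> for \<open>A\<close> gives a
  form that touches it at \<open>A\<close>.\<close>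

lemma gram_min_projection_support:
  fixes A :: "'k::rc_field^'m^'n"
  shows "\<exists>S. projection_support gram_min U A S"
proof -
  obtain x where x: "norm x = 1" "gram_min A = (norm (conj_transpose A *v x))\<^sup>2"
    using gram_min_attained by metis
  have "gram_min B \<le> B \<bullet> row_proj x B" for B :: "'k^'m^'n"
    using gram_min_le[of B x] x by (simp add: row_proj_quadratic)
  with x have "projection_support gram_min U A (row_proj x)"
    by (simp add: projection_support_def orth_proj_row_proj row_proj_quadratic)
  then show ?thesis by blast
qed

text \<open>The forms of which \<open>gram_min\<close> is the minimum are squares of the seminorms \<open>norm (S B)\<close>, all of which are
  1-Lipschitz.\<close>

lemma sqrt_gram_min_lipschitz:
  fixes A B :: "'k::rc_field^'m^'n"
  shows "sqrt (gram_min B) \<le> sqrt (gram_min A) + norm (B - A)"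
proof -
  obtain S where S: "projection_support gram_min UNIV A S" using gram_min_projection_support by blast
  then have P: "orth_proj S" and A: "gram_min A = A \<bullet> S A" and le: "gram_min B \<le> B \<bullet> S B"
    by (auto simp: projection_support_def)
  have n: "C \<bullet> S C = (norm (S C))\<^sup>2" for C
    using P unfolding power2_norm_eq_inner by (metis orth_proj_def)
  have "(norm (S (B - A)))\<^sup>2 \<le> (norm (B - A))\<^sup>2"
    using orth_proj_inner_le[OF P, of "B - A"] unfolding n by (simp add: power2_norm_eq_inner)
  then have "norm (S (B - A)) \<le> norm (B - A)" by simp
  moreover have "S B = S A + S (B - A)"
    using P by (simp add: orth_proj_def linear_diff)
  moreover have "sqrt (gram_min B) \<le> norm (S B)"
    using le unfolding n by (intro real_le_lsqrt) (auto simp: gram_min_nonneg)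
  moreover have "sqrt (gram_min A) = norm (S A)" unfolding A n by simp
  ultimately show ?thesis using norm_triangle_ineq[of "S A" "S (B - A)"] by simp
qed

lemma continuous_gram_min: "continuous_on UNIV (gram_min :: 'k::rc_field^'m^'n \<Rightarrow> real)"
proof -
  have "continuous_on UNIV (\<lambda>A :: 'k^'m^'n. sqrt (gram_min A))"
    unfolding continuous_on_iff
  proof (intro ballI allI impI)
    fix A :: "'k^'m^'n" and e :: real assume "e > 0"
    moreover have "dist (sqrt (gram_min B)) (sqrt (gram_min A)) \<le> dist B A" for B
      using sqrt_gram_min_lipschitz[of A B] sqrt_gram_min_lipschitz[of B A]
      by (simp add: dist_norm abs_le_iff norm_minus_commute)
    ultimately show "\<exists>d>0. \<forall>B\<in>UNIV. dist B A < d \<longrightarrow> dist (sqrt (gram_min B)) (sqrt (gram_min A)) < e"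
      by (meson order_le_less_trans)
  qed
  then have "continuous_on UNIV (\<lambda>A :: 'k^'m^'n. (sqrt (gram_min A))\<^sup>2)"
    by (rule continuous_on_power)
  then show ?thesis unfolding real_sqrt_pow2[OF gram_min_nonneg] .
qed

section \<open>The characteristic polynomial\<close>

lemma poly_det:
  fixes M :: "'k::comm_ring_1 poly^'n^'n"
  shows "poly (det M) z = det (\<chi> i j. poly (M $ i $ j) z)"
proof -
  have "poly (of_int k) z = of_int k" for k :: int
    by (induction k) simp_all
  then show ?thesis by (simp add: det_def poly_sum poly_prod)
qed

lemma poly_charpoly_eq_0_iff:
  fixes B :: "'k::field^'n^'n"
  shows "poly (charpoly B) z = 0 \<longleftrightarrow> (\<exists>x. x \<noteq> 0 \<and> B *v x = z *s x)"
proof -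
  define C where "C = (\<chi> i j. (if i = j then z else 0) - B $ i $ j)"
  have "poly (charpoly B) z = det C"
    unfolding charpoly_def poly_det C_def by (intro arg_cong[where f = det]) (auto simp: vec_eq_iff)
  moreover have "det C = 0 \<longleftrightarrow> (\<exists>x. x \<noteq> 0 \<and> C *v x = 0)"
    using invertible_det_nz[of C] unfolding invertible_left_inverse matrix_left_invertible_ker by blast
  moreover have "C *v x = z *s x - B *v x" for x
  proof -
    have "C $ i $ j * x $ j = (if i = j then z * x $ j else 0) - B $ i $ j * x $ j" for i j
      by (simp add: C_def left_diff_distrib)
    then show ?thesis by (simp add: vec_eq_iff matrix_vector_mult_def sum_subtractf)
  qed
  ultimately show ?thesis by (simp only: right_minus_eq) metis
qed

text \<open>In the Leibniz expansion a permutation other than the identity meets the diagonal, and with it the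
  variable, fewer than \<open>CARD('n)\<close> times.\<close>

lemma degree_charpoly:
  fixes B :: "'k::field^'n^'n"
  shows "degree (charpoly B) = CARD('n)"
proof -
  let ?P = "{p. p permutes (UNIV :: 'n set)}"
  let ?e = "\<lambda>i j. (if i = j then [:0, 1:] else 0) - [:B $ i $ j:]"
  let ?t = "\<lambda>p. of_int (sign p) * (\<Prod>i\<in>UNIV. ?e i (p i))"
  have e: "degree (?e i j) \<le> (if i = j then 1 else 0)" for i j by simp
  have lt: "degree (?t p) < CARD('n)" if "p \<in> ?P - {id}" for p
  proof -
    have "p \<noteq> id" using that by blast
    then obtain i where i: "p i \<noteq> i" by (metis eq_id_iff)
    have "degree (\<Prod>i\<in>UNIV. ?e i (p i)) \<le> (\<Sum>i\<in>UNIV. degree (?e i (p i)))"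
      by (rule order_trans[OF degree_prod_sum_le]) simp_all
    also have "\<dots> \<le> (\<Sum>i\<in>UNIV. if i = p i then 1 else 0)"
      by (intro sum_mono e)
    also have "\<dots> < (\<Sum>i\<in>(UNIV :: 'n set). 1)"
      using i by (intro sum_strict_mono_ex1) (auto intro!: exI[of _ i])
    finally have "degree (\<Prod>i\<in>UNIV. ?e i (p i)) < CARD('n)" by simp
    moreover have "degree (?t p) = degree (\<Prod>i\<in>UNIV. ?e i (p i))"
      by (cases p rule: sign_cases) (simp_all only: of_int_1 of_int_minus mult_1 mult_minus1 degree_minus)
    ultimately show ?thesis by (simp only:)
  qed
  have "?t id = (\<Prod>i\<in>UNIV. [:- B $ i $ i, 1:])" by (simp add: sign_id)
  then have id: "degree (?t id) = CARD('n)" by (simp add: degree_prod_eq_sum_degree)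
  have "charpoly B = ?t id + (\<Sum>p\<in>?P - {id}. ?t p)"
    unfolding charpoly_def det_def
    by (subst sum.remove[of _ id]) (simp_all add: permutes_id finite_permutations)
  moreover have "degree (\<Sum>p\<in>?P - {id}. ?t p) < CARD('n)"
  proof -
    have "degree (?t p) \<le> CARD('n) - 1" if "p \<in> ?P - {id}" for p
      using lt[OF that] by linarith
    then have "degree (\<Sum>p\<in>?P - {id}. ?t p) \<le> CARD('n) - 1"
      by (intro degree_sum_le) (simp_all only: finite_permutations finite finite_Diff)
    then show ?thesis using zero_less_card_finite[where 'a = 'n] by linarith
  qed
  ultimately show ?thesis using id by (simp only: degree_add_eq_left)
qed

lemma charpoly_nonzero [simp]: "charpoly (B :: 'k::field^'n^'n) \<noteq> 0"
  using degree_charpoly[of B] by auto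

section \<open>The spectrum of the Gram matrix\<close>

abbreviation gram_poly :: "'k::rc_field^'m^'n \<Rightarrow> 'k poly"
  where "gram_poly A \<equiv> charpoly (A ** conj_transpose A)"

lemma quadratic_nonneg_imp_linear_zero:
  fixes b c :: real
  assumes "\<And>s. 0 \<le> s * b + s\<^sup>2 * c"
  shows "b = 0"
proof (rule ccontr)
  assume "b \<noteq> 0"
  define d where "d = \<bar>c\<bar> + 1"
  have d: "d > 0" "c < d" by (simp_all add: d_def)
  have "0 \<le> (- b / d) * b + (- b / d)\<^sup>2 * c" by (rule assms)
  also have "\<dots> < (- b / d) * b + (- b / d)\<^sup>2 * d"
    using d \<open>b \<noteq> 0\<close> by (intro add_strict_left_mono mult_strict_left_mono) auto
  also have "\<dots> = 0" using d by (simp add: power2_eq_square)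
  finally show False by simp
qed

text \<open>A minimizer of the Rayleigh quotient is an eigenvector: at a minimizer \<open>x\<close> the form
  \<open>(norm (A\<^sup>* y))\<^sup>2 - gram_min A * (norm y)\<^sup>2\<close> is minimal, so its first variation vanishes.\<close>

lemma gram_min_is_root:
  fixes A :: "'k::rc_field^'m^'n"
  shows "poly (gram_poly A) (of_real (gram_min A)) = 0"
proof -
  let ?A = "conj_transpose A" and ?L = "gram_min A"
  obtain x where x: "norm x = 1" "?L = (norm (?A *v x))\<^sup>2"
    using gram_min_attained by metis
  have eq: "(?A *v x) \<bullet> (?A *v h) = ?L * (x \<bullet> h)" for h
  proof -
    have "0 \<le> s * (2 * ((?A *v x) \<bullet> (?A *v h) - ?L * (x \<bullet> h)))
       + s\<^sup>2 * ((?A *v h) \<bullet> (?A *v h) - ?L * (h \<bullet> h))" for s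
    proof -
      have "?A *v (x + s *\<^sub>R h) = ?A *v x + s *\<^sub>R (?A *v h)"
        by (simp add: matrix_vector_right_distrib linear_cmul[OF bounded_linear.linear[OF matrix_vector_mul_bounded_linear]])
      with gram_min_le[of A "x + s *\<^sub>R h"]
      have "0 \<le> (?A *v x + s *\<^sub>R (?A *v h)) \<bullet> (?A *v x + s *\<^sub>R (?A *v h))
          - ?L * ((x + s *\<^sub>R h) \<bullet> (x + s *\<^sub>R h))"
        by (simp add: power2_norm_eq_inner)
      also have "\<dots> = ((?A *v x) \<bullet> (?A *v x) - ?L * (x \<bullet> x)) + (s * (2 * ((?A *v x) \<bullet> (?A *v h) - ?L * (x \<bullet> h)))
       + s\<^sup>2 * ((?A *v h) \<bullet> (?A *v h) - ?L * (h \<bullet> h)))"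
        by (simp add: inner_add_left inner_add_right inner_commute algebra_simps power2_eq_square)
      also have "(?A *v x) \<bullet> (?A *v x) - ?L * (x \<bullet> x) = 0"
        using x by (simp add: power2_norm_eq_inner[symmetric])
      finally show ?thesis by simp
    qed
    from quadratic_nonneg_imp_linear_zero[OF this] show ?thesis by simp
  qed
  have "((A ** ?A) *v x - ?L *\<^sub>R x) \<bullet> h = 0" for h
    by (simp add: inner_diff_left inner_gram eq)
  from this[of "(A ** ?A) *v x - ?L *\<^sub>R x"]
  have "(A ** ?A) *v x = of_real ?L *s x" by (simp add: vector_smult_of_real)
  moreover have "x \<noteq> 0" using x by auto
  ultimately show ?thesis unfolding poly_charpoly_eq_0_iff by blast
qed

lemma inner_smult_left: "(w *s x) \<bullet> y = x \<bullet> (conjugate w *s (y :: 'k::rc_field^'n))"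
  by (simp add: inner_vec_def inner_mult_conjugate)

text \<open>For an eigenvector \<open>x\<close> with eigenvalue \<open>z\<close>, both \<open>(z x) \<bullet> (w x)\<close> and \<open>(z x) \<bullet> (conjugate w x)\<close> equal
  inner products of multiples of \<open>A\<^sup>* x\<close>, and they agree by adjointness; dividing by \<open>(norm x)\<^sup>2\<close> shows that
  \<open>z\<close> is self-conjugate. The bound is the Rayleigh inequality at \<open>x\<close>.\<close>

lemma gram_root_real:
  fixes A :: "'k::rc_field^'m^'n"
  assumes "poly (gram_poly A) z = 0"
  obtains t where "z = of_real t" "gram_min A \<le> t"
proof -
  let ?A = "conj_transpose A"
  obtain x where x: "x \<noteq> 0" "(A ** ?A) *v x = z *s x"
    using assms unfolding poly_charpoly_eq_0_iff by blast
  have g: "(z *s x) \<bullet> y = (?A *v x) \<bullet> (?A *v y)" for y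
    using inner_gram[of A x y] x by simp
  have "(z *s x) \<bullet> (w *s x) = (z *s x) \<bullet> (conjugate w *s x)" for w
    unfolding g vector_scalar_commute
    by (rule trans[OF inner_commute inner_smult_left])
  moreover have "(z *s x) \<bullet> (w *s x) = (norm x)\<^sup>2 * (z \<bullet> w)" for w
  proof -
    have "(z * x $ i) \<bullet> (w * x $ i) = (norm (x $ i))\<^sup>2 * (z \<bullet> w)" for i
    proof -
      have "(z * x $ i) \<bullet> (w * x $ i) = z \<bullet> (conjugate (x $ i) * x $ i * w)"
        using inner_mult_conjugate[of "x $ i" z "w * x $ i"] by (simp add: mult_ac)
      then show ?thesis unfolding conjugate_mult_self by (simp add: scaleR_conv_of_real[symmetric] del: of_real_power)
    qed
    then show ?thesis by (simp add: inner_vec_def power2_norm_eq_inner[symmetric] sum_distrib_right[symmetric])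
       (simp add: power2_norm_eq_inner inner_vec_def)
  qed
  ultimately have "z \<bullet> w = z \<bullet> conjugate w" for w using x by simp
  moreover have "z \<bullet> conjugate w = conjugate z \<bullet> w" for w
  proof -
    have "z \<bullet> conjugate w = 1 \<bullet> conjugate (z * w)"
      using inner_mult_conjugate[of z 1 "conjugate w"] by (simp add: conjugate_dist_mul)
    also have "\<dots> = (z * w) \<bullet> 1"
      using inner_mult_conjugate[of "z * w" 1 1] by simp
    also have "\<dots> = 1 \<bullet> (z * w)" by (rule inner_commute)
    also have "\<dots> = conjugate z \<bullet> w"
      using inner_mult_conjugate[of "conjugate z" 1 w] by simp
    finally show ?thesis .
  qed
  ultimately have "(z - conjugate z) \<bullet> w = 0" for w by (simp add: inner_diff_left)
  from this[of "z - conjugate z"] have "conjugate z = z" by simp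
  then obtain t where t: "z = of_real t" using self_conjugate_real[of z] by (auto simp: of_real_def)
  have "t * (norm x)\<^sup>2 = (norm (?A *v x))\<^sup>2"
    using g[of x] by (simp add: t vector_smult_of_real power2_norm_eq_inner)
  with gram_min_le[of A x] have "gram_min A * (norm x)\<^sup>2 \<le> t * (norm x)\<^sup>2" by simp
  then have "gram_min A \<le> t" by (rule mult_right_le_imp_le) (use x in simp)
  with t show ?thesis by (rule that)
qed

lemma poly_map_of_real:
  "poly (map_poly of_real p) (of_real t :: 'a::{real_algebra_1,comm_ring_1}) = of_real (poly p t)"
  by (induction p) (simp_all add: map_poly_pCons)

text \<open>By induction on the degree: a complex root exists, it is real by hypothesis, and its linear factor
  splits off over the reals.\<close>

lemma size_proots_real:
  fixes p :: "real poly"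
  assumes "p \<noteq> 0" "\<And>z. poly (map_poly complex_of_real p) z = 0 \<Longrightarrow> z \<in> \<real>"
  shows "size (proots p) = degree p"
  using assms
proof (induction "degree p" arbitrary: p)
  case 0
  then show ?case by (metis degree_eq_zeroE proots_const size_empty)
next
  case (Suc n)
  let ?c = "map_poly complex_of_real"
  have "degree (?c p) = degree p" by (simp add: degree_map_poly)
  with Suc(2) have "\<not> constant (poly (?c p))" by (simp add: constant_degree)
  then obtain z where z: "poly (?c p) z = 0" using fundamental_theorem_of_algebra by blast
  then obtain t where t: "z = of_real t" using Suc(4) by (auto elim: Reals_cases)
  have "poly (?c p) (of_real t) = of_real (poly p t)" by (simp add: poly_map_of_real)
  with z t have "poly p t = 0" by simp
  then obtain q where q: "p = [:- t, 1:] * q" unfolding poly_eq_0_iff_dvd by (elim dvdE)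
  with Suc(3) have q0: "q \<noteq> 0" by (intro notI) simp
  have deg: "degree p = Suc (degree q)"
    unfolding q by (subst degree_mult_eq) (use q0 in simp_all)
  have "?c p = [:- of_real t, 1:] * ?c q"
    unfolding q by (rule poly_eqI) (simp add: coeff_map_poly coeff_pCons split: nat.split)
  then have "z \<in> \<real>" if "poly (?c q) z = 0" for z using Suc(4)[of z] that by simp
  then have "size (proots q) = degree q" using Suc(1)[of q] Suc(2) deg q0 by simp
  moreover have "proots p = proots [:- t, 1:] + proots q"
    unfolding q by (rule proots_mult) (use q0 in simp_all)
  ultimately show ?case unfolding deg by simp
qed

lemma size_proots_gram_poly_complex:
  fixes A :: "complex^'m^'n"
  shows "size (proots (gram_poly A)) = CARD('n)"
  by (simp add: size_proots_complex degree_charpoly)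

text \<open>The complex roots of the characteristic polynomial are the eigenvalues of the Gram matrix of the
  complexification of \<open>A\<close>, which are real.\<close>

lemma size_proots_gram_poly_real:
  fixes A :: "real^'m^'n"
  shows "size (proots (gram_poly A)) = CARD('n)"
proof -
  define C :: "complex^'m^'n" where "C = (\<chi> i j. of_real (A $ i $ j))"
  have G: "(C ** conj_transpose C) $ i $ j = of_real ((A ** conj_transpose A) $ i $ j)" for i j
    by (simp add: C_def matrix_matrix_mult_def)
  have "poly (map_poly complex_of_real (gram_poly A)) (of_real t) = poly (gram_poly C) (of_real t)" for t
  proof -
    have "poly (map_poly complex_of_real (gram_poly A)) (of_real t) = of_real (poly (gram_poly A) t)"
      by (simp add: poly_map_of_real)
    also have "\<dots> = poly (gram_poly C) (of_real t)"
    proof -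
      have "complex_of_real (poly ((if i = j then [:0, 1:] else 0) - [:b:]) t)
          = poly ((if i = j then [:0, 1:] else 0) - [:of_real b:]) (of_real t)" for i j :: 'n and b
        by simp
      then show ?thesis
        unfolding charpoly_def poly_det
        by (simp only: det_def of_real_sum of_real_mult of_real_of_int_eq of_real_prod vec_lambda_beta G)
    qed
    finally show ?thesis .
  qed
  note agree = this
  let ?T = "complex_of_real ` real ` {..CARD('n)}"
  have card: "card ?T = Suc CARD('n)" by (simp add: card_image inj_on_def)
  have eq: "map_poly complex_of_real (gram_poly A) = gram_poly C"
  proof (rule poly_eqI_degree)
    show "poly (map_poly complex_of_real (gram_poly A)) z = poly (gram_poly C) z" if "z \<in> ?T" for z
      using that by (elim imageE) (simp only: agree)
    show "degree (map_poly complex_of_real (gram_poly A)) < card ?T"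
      unfolding card by (simp add: degree_map_poly degree_charpoly)
    show "degree (gram_poly C) < card ?T" unfolding card by (simp add: degree_charpoly)
  qed
  show ?thesis
    unfolding degree_charpoly[of "A ** conj_transpose A", symmetric]
  proof (rule size_proots_real)
    fix z assume "poly (map_poly complex_of_real (gram_poly A)) z = 0"
    then have "poly (gram_poly C) z = 0" unfolding eq .
    then obtain t where "z = of_real t" by (rule gram_root_real)
    then show "z \<in> \<real>" by simp
  qed simp
qed

section \<open>The smallest singular value\<close>

context
  fixes A :: "'k::rc_field^'m^'n"
  assumes split: "size (proots (gram_poly A)) = CARD('n)"
begin

text \<open>The roots of the characteristic polynomial are reals above the root \<open>gram_min A\<close>, so sorting puts one copy
  of \<open>sqrt (gram_min A)\<close> last in the list of singular values. The rest \<open>ys\<close> contains a further copy exactly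
  if the root is multiple.\<close>

lemma singular_values_split:
  obtains ys where "singular_values A = rev (sqrt (gram_min A) # ys)" "length ys = CARD('n) - 1"
    "sorted ys" "\<And>y. y \<in> set ys \<Longrightarrow> sqrt (gram_min A) \<le> y"
    "sqrt (gram_min A) \<in> set ys \<longleftrightarrow> poly (pderiv (gram_poly A)) (of_real (gram_min A)) = 0"
proof -
  define p where "p = gram_poly A"
  define L where "L = gram_min A"
  let ?z = "of_real L :: 'k" and ?f = "\<lambda>z :: 'k. sqrt (norm z)"
  have p0: "p \<noteq> 0" by (simp add: p_def)
  have root: "poly p ?z = 0" unfolding p_def L_def by (rule gram_min_is_root)
  have L0: "L \<ge> 0" by (simp add: L_def gram_min_nonneg)
  have "?z \<in># proots p" using root p0 by simp
  then obtain M where M: "proots p = add_mset ?z M" by (metis multi_member_split)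
  have fz: "?f ?z = sqrt L" using L0 by simp
  have elems: "sqrt L \<le> ?f z \<and> (?f z = sqrt L \<longrightarrow> z = ?z)" if "z \<in># M" for z
  proof -
    have "z \<in># proots p" using that M by simp
    then have "poly p z = 0" using p0 by simp
    then obtain t where "z = of_real t" "L \<le> t"
      unfolding p_def L_def by (rule gram_root_real)
    then show ?thesis using L0 by simp
  qed
  define ys where "ys = sorted_list_of_multiset (image_mset ?f M)"
  have "sorted_list_of_multiset (image_mset ?f (proots p)) = insort (sqrt L) ys"
    unfolding M ys_def by (simp only: image_mset_add_mset sorted_list_of_multiset_insert fz)
  also have "\<dots> = sqrt L # ys"
    using elems by (intro insort_is_Cons) (auto simp: ys_def)
  finally have 1: "singular_values A = rev (sqrt L # ys)"
    by (simp add: singular_values_def p_def)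
  have "size (mset ys) = size M" by (simp add: ys_def)
  then have "length ys = size M" by simp
  moreover have "size M = CARD('n) - 1" using split M by (simp add: p_def)
  ultimately have 2: "length ys = CARD('n) - 1" by simp
  have set: "set ys = ?f ` set_mset M" by (simp add: ys_def)
  have "sqrt L \<in> set ys \<longleftrightarrow> ?z \<in># M"
  proof
    assume "sqrt L \<in> set ys"
    then obtain z where "z \<in># M" "?f z = sqrt L" unfolding set by auto
    with elems[of z] show "?z \<in># M" by simp
  next
    assume "?z \<in># M"
    then have "?f ?z \<in> set ys" unfolding set by (rule imageI)
    then show "sqrt L \<in> set ys" unfolding fz .
  qed
  also have "\<dots> \<longleftrightarrow> order ?z p \<noteq> 1"
  proof -
    have "order ?z p = Suc (count M ?z)" using count_proots[OF p0, of ?z] M by simp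
    then show ?thesis by (simp add: count_eq_zero_iff)
  qed
  also have "\<dots> \<longleftrightarrow> poly (pderiv p) ?z = 0"
  proof -
    have "degree p \<noteq> 0" unfolding p_def degree_charpoly by simp
    then have "pderiv p \<noteq> 0" by (simp add: pderiv_eq_0_iff)
    then show ?thesis
      using order_pderiv[OF p0 root] order_root[of "pderiv p" ?z] by simp
  qed
  finally show ?thesis
    using 1 2 set elems by (intro that[of ys]) (auto simp: p_def L_def ys_def)
qed

lemma sing_val_smallest: "sing_val CARD('n) A = sqrt (gram_min A)"
proof -
  obtain ys where "singular_values A = rev (sqrt (gram_min A) # ys)" "length ys = CARD('n) - 1"
    using singular_values_split by metis
  then show ?thesis by (simp add: sing_val_def nth_append)
qed

text \<open>For \<open>CARD('n) = 1\<close> both sides hold: the characteristic polynomial is linear.\<close>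

lemma sing_val_gap_iff_simple:
  "(1 < CARD('n) \<longrightarrow> sing_val (CARD('n) - 1) A > sing_val CARD('n) A)
    \<longleftrightarrow> poly (pderiv (gram_poly A)) (of_real (gram_min A)) \<noteq> 0"
proof -
  obtain ys where ys: "singular_values A = rev (sqrt (gram_min A) # ys)" "length ys = CARD('n) - 1"
    "sorted ys" "\<And>y. y \<in> set ys \<Longrightarrow> sqrt (gram_min A) \<le> y"
    "sqrt (gram_min A) \<in> set ys \<longleftrightarrow> poly (pderiv (gram_poly A)) (of_real (gram_min A)) = 0"
    using singular_values_split by metis
  have "(1 < CARD('n) \<longrightarrow> sing_val (CARD('n) - 1) A > sing_val CARD('n) A) \<longleftrightarrow> sqrt (gram_min A) \<notin> set ys"
  proof (cases ys)
    case Nil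
    then show ?thesis using ys(2) by simp
  next
    case (Cons y zs)
    then have n: "1 < CARD('n)" using ys(2) by simp
    have "length zs = CARD('n) - 2" using Cons ys(2) by simp
    then have "sing_val (CARD('n) - 1) A = y"
      using n by (simp add: sing_val_def ys(1) Cons nth_append numeral_2_eq_2)
    moreover have "sqrt (gram_min A) < y \<longleftrightarrow> sqrt (gram_min A) \<notin> set ys"
    proof -
      have "y \<in> set ys" "\<And>x. x \<in> set ys \<Longrightarrow> y \<le> x" using ys(3) Cons by auto
      then show ?thesis using ys(4)[of y] by (metis not_le order_le_less)
    qed
    ultimately show ?thesis using n by (simp only: sing_val_smallest simp_thms)
  qed
  then show ?thesis using ys(5) by blast
qed

end

lemma rank_full_iff:
  fixes A :: "'k::field^'m^'n"
  shows "rank A = CARD('n) \<longleftrightarrow> (\<forall>c. (\<Sum>i\<in>UNIV. c i *s row i A) = 0 \<longrightarrow> (\<forall>i. c i = 0))"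
proof -
  have rows: "rows A = range (\<lambda>i. row i A)" by (auto simp: rows_def)
  have fin: "finite (rows A)" unfolding rows by simp
  have reindex: "(\<Sum>v\<in>rows A. u v *s v) = (\<Sum>i\<in>UNIV. u (row i A) *s row i A)"
    if "inj (\<lambda>i. row i A)" for u
    unfolding rows using that by (simp add: sum.reindex)
  show ?thesis
  proof (intro iffI allI impI)
    fix c i
    assume r: "rank A = CARD('n)" and c: "(\<Sum>i\<in>UNIV. c i *s row i A) = 0"
    have "card (rows A) \<le> CARD('n)" unfolding rows by (rule card_image_le) simp
    moreover have "vec.dim (rows A) \<le> card (rows A)" by (rule vec.dim_le_card'[OF fin])
    ultimately have card: "card (rows A) = CARD('n)" "card (rows A) = vec.dim (rows A)"
      using r unfolding row_rank_def_gen by simp_all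
    have inj: "inj (\<lambda>i. row i A)" using card(1) unfolding rows by (intro eq_card_imp_inj_on) simp_all
    have ind: "vec.independent (rows A)"
      using vec.card_eq_dim[OF subset_refl card(2) fin] vec.span_superset by blast
    define u where "u v = c (inv (\<lambda>i. row i A) v)" for v
    have u: "u (row i A) = c i" for i unfolding u_def by (simp add: inv_f_f[OF inj])
    have "(\<Sum>v\<in>rows A. u v *s v) = 0" unfolding reindex[OF inj] u by (rule c)
    then have "u (row i A) = 0"
      using ind vec.dependent_finite[OF fin] unfolding rows by blast
    then show "c i = 0" unfolding u .
  next
    assume zero: "\<forall>c. (\<Sum>i\<in>UNIV. c i *s row i A) = 0 \<longrightarrow> (\<forall>i. c i = 0)"
    have inj: "inj (\<lambda>i. row i A)"
    proof (rule injI, rule ccontr)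
      fix i j assume ij: "row i A = row j A" "i \<noteq> j"
      define c :: "'n \<Rightarrow> 'k" where "c k = (if k = i then 1 else 0) - (if k = j then 1 else 0)" for k
      have "c k *s row k A = (if k = i then row k A else 0) - (if k = j then row k A else 0)" for k
        by (simp add: c_def vec.scale_left_diff_distrib)
      then have "(\<Sum>k\<in>UNIV. c k *s row k A) = 0" using ij by (simp add: sum_subtractf)
      with zero have "c i = 0" by blast
      with ij show False by (simp add: c_def)
    qed
    have "vec.independent (rows A)"
      unfolding vec.dependent_finite[OF fin] reindex[OF inj]
    proof (intro notI, elim exE conjE bexE)
      fix u v assume u: "(\<Sum>i\<in>UNIV. u (row i A) *s row i A) = 0" and "v \<in> rows A" "u v \<noteq> 0"
      then obtain i where "u (row i A) \<noteq> 0" unfolding rows by blast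
      with zero[rule_format, OF u] show False by simp
    qed
    then have "vec.dim (rows A) = card (rows A)" by (rule vec.dim_eq_card_independent)
    also have "\<dots> = CARD('n)" unfolding rows using inj by (rule card_image)
    finally show "rank A = CARD('n)" unfolding row_rank_def_gen .
  qed
qed

text \<open>A vanishing combination of the rows of \<open>A\<close> is, after conjugation of the coefficients, a vector in the
  kernel of \<open>A\<^sup>*\<close>.\<close>

lemma rank_full_iff_gram_min_pos:
  fixes A :: "'k::rc_field^'m^'n"
  shows "rank A = CARD('n) \<longleftrightarrow> gram_min A > 0"
proof -
  have conj: "(\<Sum>i\<in>UNIV. c i *s row i A) = 0 \<longleftrightarrow> conj_transpose A *v (\<chi> i. conjugate (c i)) = 0" for c
  proof -
    have "(conj_transpose A *v (\<chi> i. conjugate (c i))) $ j = conjugate ((\<Sum>i\<in>UNIV. c i *s row i A) $ j)" for j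
      by (simp add: matrix_vector_mult_def sum_conjugate conjugate_dist_mul row_def mult.commute)
    then show ?thesis by (simp add: vec_eq_iff)
  qed
  have "rank A = CARD('n) \<longleftrightarrow> (\<forall>x. conj_transpose A *v x = 0 \<longrightarrow> x = 0)"
    unfolding rank_full_iff conj
  proof (intro iffI allI impI)
    fix x assume *: "\<forall>c. conj_transpose A *v (\<chi> i. conjugate (c i)) = 0 \<longrightarrow> (\<forall>i. c i = 0)"
      and x: "conj_transpose A *v x = 0"
    have "(\<chi> i. conjugate (conjugate (x $ i))) = x" by (simp add: vec_eq_iff)
    with *[rule_format, of "\<lambda>i. conjugate (x $ i)"] x show "x = 0" by (simp add: vec_eq_iff)
  next
    fix c i assume "\<forall>x. conj_transpose A *v x = 0 \<longrightarrow> x = 0"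
      and "conj_transpose A *v (\<chi> i. conjugate (c i)) = 0"
    then have "(\<chi> i. conjugate (c i)) = 0" by blast
    then show "c i = 0" by (simp add: vec_eq_iff)
  qed
  also have "\<dots> \<longleftrightarrow> gram_min A > 0"
  proof
    assume ker: "\<forall>x. conj_transpose A *v x = 0 \<longrightarrow> x = 0"
    obtain x where x: "norm x = 1" "gram_min A = (norm (conj_transpose A *v x))\<^sup>2"
      using gram_min_attained by metis
    then have "conj_transpose A *v x \<noteq> 0" using ker by force
    then show "gram_min A > 0" unfolding x(2) by simp
  next
    assume pos: "gram_min A > 0"
    show "\<forall>x. conj_transpose A *v x = 0 \<longrightarrow> x = 0"
    proof (intro allI impI)
      fix x assume "conj_transpose A *v x = 0"
      with gram_min_le[of A x] have "gram_min A * (norm x)\<^sup>2 \<le> 0" by simp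
      with pos show "x = 0" by (simp add: mult_le_0_iff)
    qed
  qed
  finally show ?thesis .
qed

section \<open>Smoothness of the smallest eigenvalue\<close>

lemma Ck_on_coeff_sum:
  assumes "open U" "\<And>a i. a \<in> I \<Longrightarrow> Ck_on k U (\<lambda>x. coeff (p a x) i)"
  shows "Ck_on k U (\<lambda>x. coeff (\<Sum>a\<in>I. p a x) i)"
  unfolding coeff_sum using assms by (intro Ck_on_sum) auto

lemma Ck_on_coeff_mult:
  fixes p q :: "'e::euclidean_space \<Rightarrow> 'k::real_normed_field poly"
  assumes "open U" "\<And>i. Ck_on k U (\<lambda>x. coeff (p x) i)" "\<And>i. Ck_on k U (\<lambda>x. coeff (q x) i)"
  shows "Ck_on k U (\<lambda>x. coeff (p x * q x) i)"
  unfolding coeff_mult using assms by (intro Ck_on_sum Ck_on_mult) auto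

lemma Ck_on_coeff_prod:
  fixes p :: "'a \<Rightarrow> 'e::euclidean_space \<Rightarrow> 'k::real_normed_field poly"
  assumes "open U" "\<And>a i. a \<in> I \<Longrightarrow> Ck_on k U (\<lambda>x. coeff (p a x) i)"
  shows "Ck_on k U (\<lambda>x. coeff (\<Prod>a\<in>I. p a x) i)"
  using assms(2)
  by (induction I arbitrary: i rule: infinite_finite_induct)
    (auto intro: Ck_on_const Ck_on_coeff_mult \<open>open U\<close>)

lemma Ck_on_coeff_charpoly:
  fixes B :: "'e::euclidean_space \<Rightarrow> 'k::real_normed_field^'n^'n"
  assumes U: "open U" and B: "\<And>i j. Ck_on k U (\<lambda>x. B x $ i $ j)"
  shows "Ck_on k U (\<lambda>x. coeff (charpoly (B x)) l)"
proof -
  have entry: "Ck_on k U (\<lambda>x. coeff ((if i = j then [:0, 1:] else 0) - [:B x $ i $ j:]) l)" for i j l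
  proof -
    have "Ck_on k U (\<lambda>x. coeff (if i = j then [:0, 1:] else 0) l + (- (if l = 0 then 1 else 0)) * B x $ i $ j)"
      by (intro Ck_on_add Ck_on_mult Ck_on_const U B)
    then show ?thesis
      by (rule Ck_on_cong[OF U, rotated]) (simp add: coeff_pCons split: nat.split)
  qed
  show ?thesis
    unfolding charpoly_def det_def vec_lambda_beta
    by (intro Ck_on_coeff_sum Ck_on_coeff_mult Ck_on_coeff_prod Ck_on_const U entry)
qed

lemma Ck_on_coeff_gram_poly:
  assumes U: "open (U :: ('k::rc_field^'m^'n) set)"
  shows "Ck_on k U (\<lambda>A. coeff (gram_poly A) l)"
proof -
  have nth: "bounded_linear (\<lambda>A :: 'k^'m^'n. A $ i $ j)" for i j
    by (intro bounded_linear_compose[OF bounded_linear_vec_nth bounded_linear_vec_nth])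
  have cnj: "bounded_linear (conjugate :: 'k \<Rightarrow> 'k)"
    using linear_conjugate by (simp add: linear_conv_bounded_linear)
  have "Ck_on k U (\<lambda>A. (A ** conj_transpose A) $ i $ j)" for i j
    unfolding matrix_matrix_mult_def vec_lambda_beta conj_transpose_nth
    by (intro Ck_on_sum Ck_on_mult Ck_on_linear_comp[OF U cnj] Ck_on_bounded_linear[OF U nth] U)
  then show ?thesis by (rule Ck_on_coeff_charpoly[OF U])
qed

text \<open>The set \<open>GL_simple\<close>, described by conditions that are visibly open.\<close>

definition simple_gram :: "('k::rc_field^'m^'n) set"
  where "simple_gram = {A. gram_min A > 0 \<and> poly (pderiv (gram_poly A)) (of_real (gram_min A)) \<noteq> 0}"

lemma open_simple_gram: "open (simple_gram :: ('k::rc_field^'m^'n) set)"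
proof -
  have "continuous_on UNIV (\<lambda>A :: 'k^'m^'n. poly (pderiv (gram_poly A)) (of_real (gram_min A)))"
    unfolding poly_pderiv_eq_sum_le[OF eq_refl[OF degree_charpoly]]
    by (intro continuous_intros continuous_gram_min Ck_on_imp_continuous_on[OF Ck_on_coeff_gram_poly] open_UNIV)
  then have "open {A :: 'k^'m^'n. poly (pderiv (gram_poly A)) (of_real (gram_min A)) \<noteq> 0}"
    by (intro open_Collect_neq continuous_on_const)
  moreover have "open {A :: 'k^'m^'n. gram_min A > 0}"
    by (intro open_Collect_less continuous_gram_min continuous_on_const)
  ultimately show ?thesis unfolding simple_gram_def by (rule open_Collect_conj[rotated])
qed

lemma Ck_on_gram_min: "Ck_on k (simple_gram :: ('k::rc_field^'m^'n) set) gram_min"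
proof -
  let ?U = "simple_gram :: ('k^'m^'n) set"
  have "Ck_on k ?U (\<lambda>A. of_real (gram_min A) :: 'k)"
  proof (rule Ck_on_simple_root[OF open_simple_gram eq_refl[OF degree_charpoly] Ck_on_coeff_gram_poly[OF open_simple_gram]])
    show "continuous_on ?U (\<lambda>A. of_real (gram_min A) :: 'k)"
      by (intro continuous_intros continuous_on_subset[OF continuous_gram_min]) auto
  qed (auto simp: gram_min_is_root simple_gram_def)
  from Ck_on_linear_comp[OF open_simple_gram bounded_linear_inner_left[of 1] this]
  have "Ck_on k ?U (\<lambda>A. (of_real (gram_min A) :: 'k) \<bullet> 1)" .
  moreover have "(of_real t :: 'k) \<bullet> 1 = t" for t by (simp add: of_real_def power2_norm_eq_inner[symmetric])
  ultimately show ?thesis by simp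
qed

text \<open>The hypothesis on the roots holds for both scalar fields, but for different reasons.\<close>

theorem self_convex_sphere_GL:
  fixes r :: real
  assumes split: "\<And>A :: 'k::rc_field^'m^'n. size (proots (gram_poly A)) = CARD('n)" and "r > 0"
  shows "self_convex (sphere_GL r :: ('k^'m^'n) set) induced_metric (\<lambda>A. 1 / (sing_val CARD('n) A)\<^sup>2)"
proof -
  have GL: "(GL_simple :: ('k^'m^'n) set) = simple_gram"
    unfolding GL_simple_def simple_gram_def
    by (simp only: rank_full_iff_gram_min_pos sing_val_gap_iff_simple[OF split])
  have "(sing_val CARD('n) A)\<^sup>2 = gram_min A" for A :: "'k^'m^'n"
    by (simp add: sing_val_smallest[OF split] gram_min_nonneg)
  then show ?thesis
    unfolding sphere_GL_def GL
    by (simp only:) (rule self_convex_sphere[OF open_simple_gram \<open>r > 0\<close> Ck_on_gram_min _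
        gram_min_projection_support], simp add: simple_gram_def)
qed

theorem corollary6:
  fixes r :: real
  assumes "CARD('n::finite) \<le> CARD('m::finite)" and "r > 0"
  shows "self_convex (sphere_GL r :: (real^'m^'n) set) induced_metric
           (\<lambda>A. 1 / (sing_val CARD('n) A)\<^sup>2) \<and>
         self_convex (sphere_GL r :: (complex^'m^'n) set) induced_metric
           (\<lambda>A. 1 / (sing_val CARD('n) A)\<^sup>2)"
  using self_convex_sphere_GL[OF size_proots_gram_poly_real \<open>r > 0\<close>]
    self_convex_sphere_GL[OF size_proots_gram_poly_complex \<open>r > 0\<close>] by blast

end
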